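(* Let $n,k$ be positive integers. On $(\mathbf{YT}_{A_n}\times\mathbb{N}_0)^{\times k}$, the operators $s_i$ ($1\le i<n$) defined below commute with each of the maps $b_l=\mathrm{Id}^{\times(l-1)}\times\boldsymbol{\sigma}_R\times\mathrm{Id}^{\times(k-l-1)}$ ($1\le l<k$); hence the letter permuting $S_n$-action and the $B_k^+$-action via $\boldsymbol{\sigma}_R$ commute. Likewise, the operators $s_i$ commute with the maps $\mathrm{Id}^{\times(l-1)}\times\boldsymbol{\sigma}_C\times\mathrm{Id}^{\times(k-l-1)}$, so the $S_n$-action and the $B_k^+$-action via $\boldsymbol{\sigma}_C$ commute.
   Context: $A_n=\{1,\dots,n\}$ with the usual order, $\mathbb{N}_0=\{0,1,\dots\}$. An $A_n$-row is a non-decreasing word; $x_1\ldots x_s \succ_R y_1\ldots y_t$ means $s\le t$ and $x_m>y_m$ for $m\le s$. A Young tableau is a finite sequence $T=(r_1,\dots,r_q)$ of non-empty rows with $r_1\succ_R\cdots\succ_R r_q$, drawn left-justified with $r_1$ on top; $\operatorname{rows}(T)=q$, $\operatorname{cols}(T)$ = length of $r_q$; $\mathbf{YT}_{A_n}$ is the set of tableaux (including $\emptyset$). Row reading $\mathcal{R}(T)=r_1\cdots r_q$. Right Schensted insertion of $x$ into $T$: if $T=\emptyset$ the result is $(x)$; if $x\ge$ the last letter of $r_q$, append $x$ to $r_q$; otherwise replace the leftmost letter $x'>x$ of $r_q$ by $x$ and insert $x'$ likewise into $(r_1,\dots,r_{q-1})$, keeping the modified bottom row below. Iteration gives $\mathcal{I}(T,w)$,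 $\mathcal{T}(w)=\mathcal{I}(\emptyset,w)$, $T\ast T'=\mathcal{I}(T,\mathcal{R}(T'))$. Braiding $\boldsymbol{\sigma}_R((T_1,\alpha_1),(T_2,\alpha_2))=((T'_2,\alpha'_2),(T'_1,\alpha'_1))$: the unique pair such that the rows of $T'_2$ (on top) followed by those of $T'_1$ form $T_1\ast T_2$; $\alpha'_j+\operatorname{rows}(T'_j)=\alpha_j+\operatorname{rows}(T_j)$ for $j=1,2$; and $\alpha'_1>0$ iff $\operatorname{rows}(T_1\ast T_2)<\alpha_1+\operatorname{rows}(T_1)$, in which case $T'_2=\emptyset$. Braiding $\boldsymbol{\sigma}_C$: same with columns, namely the columns of $T'_2$ (left) followed by those of $T'_1$ (right) form $T_1\ast T_2$; $\alpha'_j+\operatorname{cols}(T'_j)=\alpha_j+\operatorname{cols}(T_j)$; and $\alpha'_2>0$ iff $\operatorname{cols}(T_1\ast T_2)<\alpha_2+\operatorname{cols}(T_2)$, in which case $T'_1=\emptyset$. The operator $s_i$ on words: in the subsequence of letters equal to $i$ or $i+1$, regarded cyclically, repeatedly match an unmatched $i+1$ with an unmatched $i$ immediately following it among unmatched letters in cyclic order, until the unmatched letters are all $i$ or all $i+1$; then change every unmatched $i$ into $i+1$, resp. every unmatched $i+1$ into $i$. On tuples: $s_i((T_1,\alpha_1),\dots,(T_k,\alpha_k))=((\widetilde{T_1},\alpha_1),\dots,(\widetilde{T_k},\alpha_k))$, where one writes $s_i(\mathcal{R}(T_1)\cdots\mathcal{R}(T_k))=\widetilde{w_1}\cdots\widetilde{w_k}$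 with $\widetilde{w_j}$ of the same length as $\mathcal{R}(T_j)$ and sets $\widetilde{T_j}=\mathcal{T}(\widetilde{w_j})$ (each $\widetilde{w_j}$ is the row reading of a tableau of the same shape as $T_j$, and the result is the same if column readings are used instead). These operators define an action of the symmetric group $S_n$. *)

theory Defs
  imports "HOL-Algebra.Group_Action" "HOL-Algebra.Sym_Groups"
begin

section \<open>Young tableaux over \<open>A\<^sub>n = {1..n}\<close>\<close>

text \<open>A tableau is the list of its rows, the top (shortest) row first.\<close>

type_synonym tableau = "nat list list"

definition dominates_row :: "nat list \<Rightarrow> nat list \<Rightarrow> bool" where
  "dominates_row x y \<longleftrightarrow> length x \<le> length y \<and> (\<forall>m<length x. x ! m > y ! m)"

definition YT :: "nat \<Rightarrow> tableau set" where
  "YT n = {T. (\<forall>r\<in>set T. r \<noteq> [] \<and> sorted r \<and> set r \<subseteq> {1..n}) \<and> successively dominates_row T}"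

definition nrows :: "tableau \<Rightarrow> nat" where
  "nrows T = length T"

definition ncols :: "tableau \<Rightarrow> nat" where
  "ncols T = (if T = [] then 0 else length (last T))"

text \<open>Columns from left to right. As rows are left-justified and get longer downwards, column
  \<open>m\<close> (counted from 0) meets exactly the rows of length greater than \<open>m\<close>.\<close>

definition columns :: "tableau \<Rightarrow> nat list list" where
  "columns T = map (\<lambda>m. map (\<lambda>r. r ! m) (filter (\<lambda>r. m < length r) T)) [0..<ncols T]"

definition row_reading :: "tableau \<Rightarrow> nat list" where
  "row_reading T = concat T"


section \<open>Right Schensted insertion\<close>

text \<open>Insertion starts in the bottom row and bumps upwards, so the auxiliary recursion
  runs over the list of rows with the bottom row first.\<close>

primrec insert_upwards :: "nat \<Rightarrow> nat list list \<Rightarrow> nat list list" where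
  "insert_upwards x [] = [[x]]"
| "insert_upwards x (r # rs) =
     (if x \<ge> last r then (r @ [x]) # rs
      else (takeWhile (\<lambda>y. y \<le> x) r @ x # tl (dropWhile (\<lambda>y. y \<le> x) r))
           # insert_upwards (hd (dropWhile (\<lambda>y. y \<le> x) r)) rs)"

definition schensted_insert :: "tableau \<Rightarrow> nat \<Rightarrow> tableau" where
  "schensted_insert T x = rev (insert_upwards x (rev T))"

definition insert_word :: "tableau \<Rightarrow> nat list \<Rightarrow> tableau" where
  "insert_word T w = foldl schensted_insert T w"

definition tableau_of :: "nat list \<Rightarrow> tableau" where
  "tableau_of w = insert_word [] w"

definition tableau_prod :: "tableau \<Rightarrow> tableau \<Rightarrow> tableau" (infixl "\<star>" 70) where
  "T \<star> T' = insert_word T (row_reading T')"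


section \<open>The braidings\<close>

type_synonym padded = "tableau \<times> nat"

text \<open>Both braidings return the pair in the order \<open>((T\<^sub>2', \<alpha>\<^sub>2'), (T\<^sub>1', \<alpha>\<^sub>1'))\<close>.\<close>

definition sigma_R :: "nat \<Rightarrow> padded \<times> padded \<Rightarrow> padded \<times> padded" where
  "sigma_R n = (\<lambda>((T1, a1), (T2, a2)).
     THE P. \<exists>T1' a1' T2' a2'. P = ((T2', a2'), (T1', a1')) \<and>
       T1' \<in> YT n \<and> T2' \<in> YT n \<and>
       T2' @ T1' = T1 \<star> T2 \<and>
       a1' + nrows T1' = a1 + nrows T1 \<and>
       a2' + nrows T2' = a2 + nrows T2 \<and>
       (a1' > 0 \<longleftrightarrow> nrows (T1 \<star> T2) < a1 + nrows T1) \<and>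
       (a1' > 0 \<longrightarrow> T2' = []))"

definition sigma_C :: "nat \<Rightarrow> padded \<times> padded \<Rightarrow> padded \<times> padded" where
  "sigma_C n = (\<lambda>((T1, a1), (T2, a2)).
     THE P. \<exists>T1' a1' T2' a2'. P = ((T2', a2'), (T1', a1')) \<and>
       T1' \<in> YT n \<and> T2' \<in> YT n \<and>
       columns T2' @ columns T1' = columns (T1 \<star> T2) \<and>
       a1' + ncols T1' = a1 + ncols T1 \<and>
       a2' + ncols T2' = a2 + ncols T2 \<and>
       (a2' > 0 \<longleftrightarrow> ncols (T1 \<star> T2) < a2 + ncols T2) \<and>
       (a2' > 0 \<longrightarrow> T1' = []))"

definition tuples :: "nat \<Rightarrow> nat \<Rightarrow> padded list set" where
  "tuples n k = {t. length t = k \<and> set t \<subseteq> YT n \<times> UNIV}"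

text \<open>\<open>Id\<^sup>l\<^sup>-\<^sup>1 \<times> \<sigma> \<times> Id\<^sup>k\<^sup>-\<^sup>l\<^sup>-\<^sup>1\<close>, with \<open>l\<close> counted from 1:
  \<open>\<sigma>\<close> is applied to the list entries with indices \<open>l - 1\<close> and \<open>l\<close>.\<close>

definition braid_at :: "('a \<times> 'a \<Rightarrow> 'a \<times> 'a) \<Rightarrow> nat \<Rightarrow> 'a list \<Rightarrow> 'a list" where
  "braid_at \<sigma> l t =
     (let (a, b) = \<sigma> (t ! (l - 1), t ! l) in take (l - 1) t @ [a, b] @ drop (l + 1) t)"


section \<open>The letter permuting operators\<close>

text \<open>\<open>cyc_between p r q\<close>: running cyclically forwards from position \<open>p\<close>, one meets \<open>r\<close>
  strictly before \<open>q\<close>.\<close>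

definition cyc_between :: "nat \<Rightarrow> nat \<Rightarrow> nat \<Rightarrow> bool" where
  "cyc_between p r q \<longleftrightarrow> (if p < q then p < r \<and> r < q else p < r \<or> r < q)"

text \<open>\<open>unmatched i w U\<close>: some stage of the cyclic matching procedure on the letters \<open>i\<close> and
  \<open>i + 1\<close> of \<open>w\<close> leaves exactly the positions in \<open>U\<close> unmatched.\<close>

inductive unmatched :: "nat \<Rightarrow> nat list \<Rightarrow> nat set \<Rightarrow> bool" for i w where
  start: "unmatched i w {p. p < length w \<and> w ! p \<in> {i, i + 1}}"
| pair: "\<lbrakk>unmatched i w U; p \<in> U; q \<in> U; w ! p = i + 1; w ! q = i;
          \<forall>r\<in>U. \<not> cyc_between p r q\<rbrakk> \<Longrightarrow> unmatched i w (U - {p, q})"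

definition switch_letters :: "nat \<Rightarrow> nat set \<Rightarrow> nat list \<Rightarrow> nat list" where
  "switch_letters i U w =
     map (\<lambda>p. if p \<in> U then (if w ! p = i then i + 1 else i) else w ! p) [0..<length w]"

text \<open>The matching procedure is non-deterministic, but its final set of unmatched positions is
  not.\<close>

definition s_word :: "nat \<Rightarrow> nat list \<Rightarrow> nat list" where
  "s_word i w = (THE w'. \<exists>U. unmatched i w U \<and>
     ((\<forall>p\<in>U. w ! p = i) \<or> (\<forall>p\<in>U. w ! p = i + 1)) \<and> w' = switch_letters i U w)"

text \<open>Cut a word into consecutive factors of prescribed lengths.\<close>

primrec cut_word :: "nat list \<Rightarrow> 'a list \<Rightarrow> 'a list list" where
  "cut_word [] w = []"
| "cut_word (m # ms) w = take m w # cut_word ms (drop m w)"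

definition s_tuple :: "nat \<Rightarrow> padded list \<Rightarrow> padded list" where
  "s_tuple i t =
     (let ws = map (\<lambda>(T, a). row_reading T) t
      in zip (map tableau_of (cut_word (map length ws) (s_word i (concat ws)))) (map snd t))"


section \<open>The positive braid monoid \<open>B\<^sub>k\<^sup>+\<close>\<close>

text \<open>Words in the generators \<open>1, \<dots>, k - 1\<close> modulo the braid relations. The relations do
  not change the set of letters of a word, so the congruence class of a word over \<open>{1..<k}\<close>
  consists of words over \<open>{1..<k}\<close> only.\<close>

inductive braid_step :: "nat list \<Rightarrow> nat list \<Rightarrow> bool" where
  far: "i + 2 \<le> j \<Longrightarrow> braid_step (u @ [i, j] @ v) (u @ [j, i] @ v)"
| near: "braid_step (u @ [i, i + 1, i] @ v) (u @ [i + 1, i, i + 1] @ v)"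

definition braid_class :: "nat list \<Rightarrow> nat list set" where
  "braid_class w = {w'. equivclp braid_step w w'}"

definition braid_monoid :: "nat \<Rightarrow> nat list set monoid" where
  "braid_monoid k =
     \<lparr>carrier = braid_class ` lists {1..<k},
      monoid.mult = (\<lambda>A B. \<Union>u\<in>A. \<Union>v\<in>B. braid_class (u @ v)),
      one = braid_class []\<rparr>"

lemma braid_step_append:
  assumes "braid_step u u'"
  shows "braid_step (x @ u @ y) (x @ u' @ y)"
  using assms
proof cases
  case (far i j v w)
  then show ?thesis using braid_step.far[of i j "x @ v" "w @ y"] by simp
next
  case (near v i w)
  then show ?thesis using braid_step.near[of "x @ v" i "w @ y"] by simp
qed

lemma braid_equiv_append:
  assumes "equivclp braid_step u u'"
  shows "equivclp braid_step (x @ u @ y) (x @ u' @ y)"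
  using assms
proof (induction rule: equivclp_induct)
  case base
  then show ?case by simp
next
  case (step v w)
  then have "equivclp braid_step (x @ v @ y) (x @ w @ y)"
    using braid_step_append by (metis r_into_equivclp converse_r_into_equivclp)
  with step.IH show ?case by (rule equivclp_trans)
qed

lemma braid_class_eq_iff: "braid_class u = braid_class v \<longleftrightarrow> equivclp braid_step u v"
proof -
  have "braid_class u = braid_class v \<longleftrightarrow> equivclp braid_step u = equivclp braid_step v"
    unfolding braid_class_def set_eq_iff mem_Collect_eq fun_eq_iff ..
  also have "\<dots> \<longleftrightarrow> equivclp braid_step u v"
    using equivp_evquivclp[of braid_step] unfolding equivp_def by metis
  finally show ?thesis .
qed

lemma braid_class_mult:
  "braid_class u \<otimes>\<^bsub>braid_monoid k\<^esub> braid_class v = braid_class (u @ v)"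
proof -
  have *: "braid_class (u' @ v') = braid_class (u @ v)"
    if "u' \<in> braid_class u" "v' \<in> braid_class v" for u' v'
  proof -
    have "equivclp braid_step (u @ v) (u' @ v)"
      using that(1) braid_equiv_append[of u u' "[]" v] by (simp add: braid_class_def)
    moreover have "equivclp braid_step (u' @ v) (u' @ v')"
      using that(2) braid_equiv_append[of v v' u' "[]"] by (simp add: braid_class_def)
    ultimately show ?thesis
      unfolding braid_class_eq_iff by (metis equivclp_sym equivclp_trans)
  qed
  have "u \<in> braid_class u" "v \<in> braid_class v"
    by (simp_all add: braid_class_def)
  then have "(\<Union>u'\<in>braid_class u. \<Union>v'\<in>braid_class v. braid_class (u' @ v')) = braid_class (u @ v)"
    using * by blast
  then show ?thesis
    by (simp add: braid_monoid_def)
qed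

lemma monoid_braid_monoid: "monoid (braid_monoid k)"
proof (rule monoidI)
  fix x y assume "x \<in> carrier (braid_monoid k)" "y \<in> carrier (braid_monoid k)"
  then obtain u v where "x = braid_class u" "u \<in> lists {1..<k}"
      "y = braid_class v" "v \<in> lists {1..<k}"
    by (auto simp: braid_monoid_def)
  then have "x \<otimes>\<^bsub>braid_monoid k\<^esub> y = braid_class (u @ v)" "u @ v \<in> lists {1..<k}"
    by (auto simp: braid_class_mult)
  then show "x \<otimes>\<^bsub>braid_monoid k\<^esub> y \<in> carrier (braid_monoid k)"
    by (auto simp: braid_monoid_def)
next
  show "\<one>\<^bsub>braid_monoid k\<^esub> \<in> carrier (braid_monoid k)"
    by (auto simp: braid_monoid_def)
next
  fix x y z
  assume "x \<in> carrier (braid_monoid k)" "y \<in> carrier (braid_monoid k)"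
    "z \<in> carrier (braid_monoid k)"
  then obtain u v w where "x = braid_class u" "y = braid_class v" "z = braid_class w"
    by (auto simp: braid_monoid_def)
  then show "x \<otimes>\<^bsub>braid_monoid k\<^esub> y \<otimes>\<^bsub>braid_monoid k\<^esub> z =
      x \<otimes>\<^bsub>braid_monoid k\<^esub> (y \<otimes>\<^bsub>braid_monoid k\<^esub> z)"
    by (simp add: braid_class_mult)
next
  fix x assume "x \<in> carrier (braid_monoid k)"
  then obtain u where x: "x = braid_class u"
    by (auto simp: braid_monoid_def)
  have one: "\<one>\<^bsub>braid_monoid k\<^esub> = braid_class []"
    by (simp add: braid_monoid_def)
  show "\<one>\<^bsub>braid_monoid k\<^esub> \<otimes>\<^bsub>braid_monoid k\<^esub> x = x"
    "x \<otimes>\<^bsub>braid_monoid k\<^esub> \<one>\<^bsub>braid_monoid k\<^esub> = x"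
    unfolding x one braid_class_mult by simp_all
qed


section \<open>The two actions\<close>

definition monoid_action :: "('m, 'z) monoid_scheme \<Rightarrow> 'x set \<Rightarrow> ('m \<Rightarrow> 'x \<Rightarrow> 'x) \<Rightarrow> bool" where
  "monoid_action M X \<phi> \<longleftrightarrow>
     (\<forall>a\<in>carrier M. \<forall>x\<in>X. \<phi> a x \<in> X) \<and>
     (\<forall>x\<in>X. \<phi> \<one>\<^bsub>M\<^esub> x = x) \<and>
     (\<forall>a\<in>carrier M. \<forall>b\<in>carrier M. \<forall>x\<in>X. \<phi> (a \<otimes>\<^bsub>M\<^esub> b) x = \<phi> a (\<phi> b x))"

text \<open>The letter permuting \<open>S\<^sub>n\<close>-action, and the \<open>B\<^sub>k\<^sup>+\<close>-action via a braiding \<open>\<sigma>\<close>: the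
  actions on \<open>tuples n k\<close> with the given values on generators. On \<open>tuples n k\<close> these
  values determine them uniquely.\<close>

definition is_letter_action :: "nat \<Rightarrow> nat \<Rightarrow> ((nat \<Rightarrow> nat) \<Rightarrow> padded list \<Rightarrow> padded list) \<Rightarrow> bool"
  where
  "is_letter_action n k \<rho> \<longleftrightarrow>
     group_action (sym_group n) (tuples n k) \<rho> \<and>
     (\<forall>i\<in>{1..<n}. \<forall>t\<in>tuples n k. \<rho> (Transposition.transpose i (i + 1)) t = s_tuple i t)"

definition is_braid_action ::
    "(padded \<times> padded \<Rightarrow> padded \<times> padded) \<Rightarrow> nat \<Rightarrow> nat \<Rightarrow> (nat list set \<Rightarrow> padded list \<Rightarrow> padded list) \<Rightarrow> bool"
  where
  "is_braid_action \<sigma> n k \<theta> \<longleftrightarrow>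
     monoid_action (braid_monoid k) (tuples n k) \<theta> \<and>
     (\<forall>l\<in>{1..<k}. \<forall>t\<in>tuples n k. \<theta> (braid_class [l]) t = braid_at \<sigma> l t)"

end

theory Submission
  imports Defs
begin

text \<open>Fix \<open>i\<close> and read a word from left to right with a counter: a letter \<open>i + 1\<close> increases it, a
  letter \<open>i\<close> decreases it, and a letter \<open>i\<close> met at counter \<open>0\<close> is raised to \<open>i + 1\<close>. If the counter
  ends where it started, the raised letters are exactly the unmatched ones, so \<open>s\<^sub>i\<close> is this
  raising map on such words, and it is the inverse of the raising map on all other words.

  What happens to a factor of a word depends only on the counter value before it. Hence any
  rewriting of a factor that commutes with raising from every counter value, with the same final
  value, commutes with \<open>s\<^sub>i\<close> wherever the factor occurs. Bumping a letter \<open>y\<close> out of a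
  row by a letter \<open>x\<close> is such a rewriting of the word \<open>r x\<close> into \<open>y r'\<close>. Schensted insertion is a
  sequence of these steps, so it commutes with raising, and so does cutting the resulting tableau
  between two rows. Cutting it between two columns moves the left part of each row to
  the left over the right parts of the rows above it. That step is nontrivial only if the left
  part contains \<open>i\<close> and the right parts contain \<open>i + 1\<close>, and then the letters \<open>i + 1\<close> lying above the
  letters \<open>i\<close> of the left part keep the counter high enough for nothing to be raised.\<close>

section \<open>Cyclic matching by a counter\<close>

text \<open>The counter holds the letters \<open>i + 1\<close> still waiting for a partner;
  truncated subtraction keeps it at \<open>0\<close> when an \<open>i\<close> finds none. A positive
  initial value stands for letters \<open>i + 1\<close> whose search for a partner wraps around the
  end of the word.\<close>

primrec carry :: "nat \<Rightarrow> nat \<Rightarrow> nat list \<Rightarrow> nat" where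
  "carry i c [] = c"
| "carry i c (x # w) = carry i (if x = Suc i then Suc c else if x = i then c - 1 else c) w"

primrec raised :: "nat \<Rightarrow> nat \<Rightarrow> nat list \<Rightarrow> nat list" where
  "raised i c [] = []"
| "raised i c (x # w) = (if x = i \<and> c = 0 then Suc i else x) #
     raised i (if x = Suc i then Suc c else if x = i then c - 1 else c) w"

lemma carry_append [simp]: "carry i c (u @ v) = carry i (carry i c u) v"
  by (induction u arbitrary: c) simp_all

lemma raised_append [simp]: "raised i c (u @ v) = raised i c u @ raised i (carry i c u) v"
  by (induction u arbitrary: c) simp_all

lemma length_raised [simp]: "length (raised i c w) = length w"
  by (induction w arbitrary: c) simp_all

lemma carry_neutral: "i \<notin> set w \<Longrightarrow> Suc i \<notin> set w \<Longrightarrow> carry i c w = c"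
  by (induction w) auto

lemma raised_no_lower: "i \<notin> set w \<Longrightarrow> raised i c w = w"
  by (induction w arbitrary: c) auto

text \<open>Raising can be undone from the end: a letter \<open>Suc i\<close> was an
  \<open>i\<close> if the counter after it is \<open>0\<close> and was itself otherwise, and this
  also gives the counter before it.\<close>

lemma raised_inject:
  assumes "raised i c v = raised i d w" "carry i c v = carry i d w"
  shows "c = d \<and> v = w"
proof -
  have "length v = length w" using assms(1) by (metis length_raised)
  then show ?thesis using assms
  proof (induction v w arbitrary: c d rule: list_induct2)
    case Nil
    then show ?case by simp
  next
    case (Cons x xs y ys)
    from Cons.prems Cons.IH show ?case
      by (auto split: if_splits dest!: Cons.IH)
  qed
qed

text \<open>When the raising is undone from two final counter values, the gap between the counters
  never grows. It shrinks exactly where a \<open>Suc i\<close> comes from a raised \<open>i\<close>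
  on the side of counter \<open>0\<close> and from a \<open>Suc i\<close> on the other, so a
  constant gap forces \<open>v = w\<close>.\<close>

lemma raised_monotone:
  assumes "raised i c v = raised i d w" "carry i c v \<le> carry i d w"
  shows "c \<le> d \<and> d - c \<le> carry i d w - carry i c v \<and> (d - c = carry i d w - carry i c v \<longrightarrow> v = w)"
proof -
  have "length v = length w" using assms(1) by (metis length_raised)
  then show ?thesis using assms
  proof (induction v w arbitrary: c d rule: list_induct2)
    case Nil
    then show ?case by simp
  next
    case (Cons x xs y ys)
    let ?st = "\<lambda>c x. if x = Suc i then Suc c else if x = i then c - 1 else c"
    have IH: "?st c x \<le> ?st d y \<and> ?st d y - ?st c x \<le> carry i d (y # ys) - carry i c (x # xs) \<and>
       (?st d y - ?st c x = carry i d (y # ys) - carry i c (x # xs) \<longrightarrow> xs = ys)"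
      using Cons.IH[of "?st c x" "?st d y"] Cons.prems by simp
    have "(if x = i \<and> c = 0 then Suc i else x) = (if y = i \<and> d = 0 then Suc i else y)"
      using Cons.prems by simp
    then have "c \<le> d \<and> d - c \<le> ?st d y - ?st c x \<and> (d - c = ?st d y - ?st c x \<longrightarrow> x = y)"
      using IH by (auto split: if_splits)
    then show ?case using IH by auto
  qed
qed

text \<open>Call a word balanced at \<open>c\<close> if its counter starts and ends at
  \<open>c\<close>. For two balanced words the gap of \<open>raised_monotone\<close> is the same at
  both ends, so balanced raising can be inverted without knowing the counter value.\<close>

lemma raised_fixed_unique:
  assumes "raised i c v = raised i d w" "carry i c v = c" "carry i d w = d"
  shows "v = w"
proof (cases "c \<le> d")
  case True
  then show ?thesis using raised_monotone[of i c v d w] assms by simp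
next
  case False
  then show ?thesis using raised_monotone[of i d w c v] assms by simp
qed

text \<open>The letter \<open>i + 2\<close> stands for any letter that the counter ignores.\<close>

definition masked :: "nat \<Rightarrow> nat set \<Rightarrow> nat list \<Rightarrow> nat list" where
  "masked i U w = map (\<lambda>p. if p \<in> U then w ! p else Suc (Suc i)) [0..<length w]"

text \<open>The invariant of the matching procedure. The counter value is existentially quantified
  because it changes when a pair that wraps around the end is removed.\<close>

definition raises_on :: "nat \<Rightarrow> nat list \<Rightarrow> nat set \<Rightarrow> nat list \<Rightarrow> bool" where
  "raises_on i w U w' \<longleftrightarrow> length w' = length w \<and> (\<forall>p<length w. p \<notin> U \<longrightarrow> w' ! p = w ! p) \<and>
     (\<exists>c. raised i c (masked i U w) = masked i U w' \<and> carry i c (masked i U w) = c)"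

lemma raises_on_start:
  "raises_on i w {p. p < length w \<and> w ! p \<in> {i, i + 1}} w' \<longleftrightarrow>
    (\<exists>c. raised i c w = w' \<and> carry i c w = c)"
proof -
  let ?U = "{p. p < length w \<and> w ! p \<in> {i, i + 1}}"
  have gen: "carry i c (map (\<lambda>x. if x = i \<or> x = Suc i then x else Suc (Suc i)) v) = carry i c v \<and>
    raised i c (map (\<lambda>x. if x = i \<or> x = Suc i then x else Suc (Suc i)) v) =
      map (\<lambda>x. if x = i \<or> x = Suc i then x else Suc (Suc i)) (raised i c v)" for v c
    by (induction v arbitrary: c) auto
  have m: "masked i ?U w = map (\<lambda>x. if x = i \<or> x = Suc i then x else Suc (Suc i)) w"
    unfolding masked_def by (rule nth_equalityI) auto
  have nth: "raised i c v ! p = v ! p \<or> v ! p = i \<and> raised i c v ! p = Suc i" if "p < length v" for c v p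
    using that
  proof (induction v arbitrary: c p)
    case (Cons x v)
    then show ?case by (cases p) auto
  qed simp
  show ?thesis
  proof
    assume "raises_on i w ?U w'"
    then obtain c where len: "length w' = length w"
      and off: "\<forall>p<length w. p \<notin> ?U \<longrightarrow> w' ! p = w ! p"
      and c: "raised i c (masked i ?U w) = masked i ?U w'" "carry i c (masked i ?U w) = c"
      unfolding raises_on_def by blast
    have "raised i c w = w'"
    proof (rule nth_equalityI)
      fix p assume "p < length (raised i c w)"
      then have p: "p < length w" by simp
      show "raised i c w ! p = w' ! p"
      proof (cases "p \<in> ?U")
        case True
        have "raised i c (masked i ?U w) ! p = masked i ?U w' ! p" using c(1) by simp
        then show ?thesis using True p nth[OF p, of c] len unfolding m gen[THEN conjunct2]
          by (auto simp: masked_def split: if_splits)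
      next
        case False
        then show ?thesis using off p nth[OF p, of c] by auto
      qed
    qed (simp add: len)
    moreover have "carry i c w = c" using c(2) unfolding m by (simp add: gen)
    ultimately show "\<exists>c. raised i c w = w' \<and> carry i c w = c" by blast
  next
    assume "\<exists>c. raised i c w = w' \<and> carry i c w = c"
    then obtain c where c: "raised i c w = w'" "carry i c w = c" by blast
    have off: "\<forall>p<length w. p \<notin> ?U \<longrightarrow> w' ! p = w ! p"
      using nth c by fastforce
    have "masked i ?U w' = map (\<lambda>x. if x = i \<or> x = Suc i then x else Suc (Suc i)) w'"
      unfolding masked_def
    proof (rule nth_equalityI)
      fix p assume "p < length (map (\<lambda>p. if p \<in> ?U then w' ! p else Suc (Suc i)) [0..<length w'])"
      then have p: "p < length w" using c(1) by auto
      then show "map (\<lambda>p. if p \<in> ?U then w' ! p else Suc (Suc i)) [0..<length w'] ! p =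
        map (\<lambda>x. if x = i \<or> x = Suc i then x else Suc (Suc i)) w' ! p"
        using nth[OF p, of c] c(1) by auto
    qed simp
    then show "raises_on i w ?U w'"
      unfolding raises_on_def using off c m gen by (intro conjI exI[of _ c]) auto
  qed
qed

lemma masked_split:
  assumes "p < q" "q < length w"
  shows "masked i U w = (let f = (\<lambda>p. if p \<in> U then w ! p else Suc (Suc i)) in
    map f [0..<p] @ f p # map f [Suc p..<q] @ f q # map f [Suc q..<length w])"
proof -
  have "[0..<length w] = [0..<p] @ p # [Suc p..<q] @ q # [Suc q..<length w]"
    using assms upt_add_eq_append[of 0 p "length w - p"] upt_add_eq_append[of "Suc p" q "length w - q"]
    by (simp add: upt_conv_Cons)
  then show ?thesis unfolding masked_def Let_def by simp
qed

text \<open>A pair that wraps around the end of the word starts with an \<open>i\<close> read at a positive counter and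
  ends with an \<open>i + 1\<close>. Dropping it lowers the initial counter value by one.\<close>

lemma raises_on_pair:
  assumes "U \<subseteq> {..<length w}" "p \<in> U" "q \<in> U" "w ! p = i + 1" "w ! q = i"
    and nb: "\<forall>r\<in>U. \<not> cyc_between p r q"
  shows "raises_on i w U w' \<longleftrightarrow> raises_on i w (U - {p, q}) w'"
proof -
  have pq: "p < length w" "q < length w" "p \<noteq> q" using assms by auto
  let ?f = "\<lambda>v p. if p \<in> U then v ! p else Suc (Suc i)"
  let ?V = "U - {p, q}"
  let ?g = "\<lambda>v p. if p \<in> ?V then v ! p else Suc (Suc i)"
  show ?thesis
  proof (cases "p < q")
    case True
    define A B C where "A = (\<lambda>v. map (?f v) [0..<p])" and "B = (\<lambda>v. map (?f v) [Suc p..<q])"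
      and "C = (\<lambda>v. map (?f v) [Suc q..<length w])"
    \<comment> \<open>Everything between \<open>p\<close> and \<open>q\<close> is masked, so the
      \<open>i\<close> at \<open>q\<close> meets the counter just increased at
      \<open>p\<close>.\<close>
    have B: "B v = replicate (q - Suc p) (Suc (Suc i))" for v
      unfolding B_def using nb True by (intro nth_equalityI) (auto simp: cyc_between_def)
    have U: "masked i U v = A v @ v ! p # B v @ v ! q # C v" if "length v = length w" for v
      using masked_split[of p q v i U] True pq assms that
      by (simp add: A_def B_def C_def Let_def)
    have V: "masked i ?V v = A v @ (Suc (Suc i)) # B v @ (Suc (Suc i)) # C v" if "length v = length w" for v
    proof -
      have "map (?g v) [0..<p] = A v" "map (?g v) [Suc p..<q] = B v" "map (?g v) [Suc q..<length w] = C v"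
        using True by (auto simp: A_def B_def C_def)
      then show ?thesis using masked_split[of p q v i ?V] True pq that by (simp add: Let_def)
    qed
    have nB: "carry i c (replicate m (Suc (Suc i))) = c" "raised i c (replicate m (Suc (Suc i))) = replicate m (Suc (Suc i))" for c m
      by (auto intro!: carry_neutral raised_no_lower)
    have len: "length (A v) = p" "length (C v) = length w - Suc q" for v by (auto simp: A_def C_def)
    have eqU: "(raised i c (masked i U w) = masked i U v \<and> carry i c (masked i U w) = c) \<longleftrightarrow>
      (v ! q = i \<and> v ! p = i + 1 \<and> raised i c (A w @ C w) = A v @ C v \<and> carry i c (A w @ C w) = c)"
      if "length v = length w" for v c
      using that by (auto simp: U B nB len assms(4,5))
    have eqV: "(raised i c (masked i ?V w) = masked i ?V v \<and> carry i c (masked i ?V w) = c) \<longleftrightarrow>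
      (raised i c (A w @ C w) = A v @ C v \<and> carry i c (A w @ C w) = c)"
      if "length v = length w" for v c
      using that by (auto simp: V B nB len)
    show ?thesis (is "?L \<longleftrightarrow> ?R")
    proof
      assume L: ?L
      then have l: "length w' = length w" unfolding raises_on_def by blast
      show ?R using L assms(4,5) unfolding raises_on_def eqU[OF l] eqV[OF l] by auto
    next
      assume R: ?R
      then have l: "length w' = length w" unfolding raises_on_def by blast
      have "w' ! q = i" "w' ! p = i + 1" using R assms(4,5) pq unfolding raises_on_def by auto
      then show ?L using R unfolding raises_on_def eqU[OF l] eqV[OF l] by auto
    qed
  next
    case False
    then have qp: "q < p" using pq by simp
    define A B C where "A = (\<lambda>v. map (?f v) [0..<q])" and "B = (\<lambda>v. map (?f v) [Suc q..<p])"
      and "C = (\<lambda>v. map (?f v) [Suc p..<length w])"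
    have A: "A v = replicate q (Suc (Suc i))" for v
      unfolding A_def using nb qp by (intro nth_equalityI) (auto simp: cyc_between_def)
    have C: "C v = replicate (length w - Suc p) (Suc (Suc i))" for v
      unfolding C_def using nb qp by (intro nth_equalityI) (auto simp: cyc_between_def)
    have U: "masked i U v = A v @ v ! q # B v @ v ! p # C v" if "length v = length w" for v
      using masked_split[of q p v i U] qp pq assms that
      by (simp add: A_def B_def C_def Let_def)
    have V: "masked i ?V v = A v @ (Suc (Suc i)) # B v @ (Suc (Suc i)) # C v" if "length v = length w" for v
    proof -
      have "map (?g v) [0..<q] = A v" "map (?g v) [Suc q..<p] = B v" "map (?g v) [Suc p..<length w] = C v"
        using qp by (auto simp: A_def B_def C_def)
      then show ?thesis using masked_split[of q p v i ?V] qp pq that by (simp add: Let_def)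
    qed
    have n: "carry i c (replicate m (Suc (Suc i))) = c" "raised i c (replicate m (Suc (Suc i))) = replicate m (Suc (Suc i))" for c m
      by (auto intro!: carry_neutral raised_no_lower)
    have len: "length (B v) = p - Suc q" for v by (auto simp: B_def)
    \<comment> \<open>The last unmasked letter is the \<open>i + 1\<close> at \<open>p\<close>, so
      the final counter is positive. It equals the initial one, hence \<open>c > 0\<close> and the
      \<open>i\<close> at \<open>q\<close> is not raised.\<close>
    have eqU: "(raised i c (masked i U w) = masked i U v \<and> carry i c (masked i U w) = c) \<longleftrightarrow>
      (c > 0 \<and> v ! q = i \<and> v ! p = i + 1 \<and> raised i (c - 1) (B w) = B v \<and> carry i (c - 1) (B w) = c - 1)"
      if "length v = length w" for v c
      using that by (auto simp: U A C n len assms(4,5))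
    have eqV: "(raised i c (masked i ?V w) = masked i ?V v \<and> carry i c (masked i ?V w) = c) \<longleftrightarrow>
      (raised i c (B w) = B v \<and> carry i c (B w) = c)"
      if "length v = length w" for v c
      using that by (auto simp: V A C n len)
    show ?thesis (is "?L \<longleftrightarrow> ?R")
    proof
      assume L: ?L
      then have l: "length w' = length w" unfolding raises_on_def by blast
      show ?R using L assms(4,5) unfolding raises_on_def eqU[OF l] eqV[OF l] by auto
    next
      assume R: ?R
      then have l: "length w' = length w" unfolding raises_on_def by blast
      obtain c where c: "raised i c (B w) = B w'" "carry i c (B w) = c"
        using R eqV[OF l] unfolding raises_on_def by blast
      have e: "w' ! q = i" "w' ! p = i + 1" using R assms pq unfolding raises_on_def by auto
      have "raised i (Suc c) (masked i U w) = masked i U w' \<and> carry i (Suc c) (masked i U w) = Suc c"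
        unfolding eqU[OF l] using c e by simp
      then show ?L using R unfolding raises_on_def by blast
    qed
  qed
qed

section \<open>Stages of the matching and the values of \<open>s_word\<close>\<close>

lemma unmatched_subset: "unmatched i w U \<Longrightarrow> U \<subseteq> {p. p < length w \<and> w ! p \<in> {i, i + 1}}"
  by (induction rule: unmatched.induct) auto

text \<open>Removing a pair preserves \<open>raises_on\<close>, so every stage, whatever pairs were
  chosen, describes the same words \<open>w'\<close> as the start.\<close>

lemma unmatched_raises_on:
  assumes "unmatched i w U"
  shows "raises_on i w U w' \<longleftrightarrow> (\<exists>c. raised i c w = w' \<and> carry i c w = c)"
  using assms
proof (induction rule: unmatched.induct)
  case start
  then show ?case by (rule raises_on_start)
next
  case (pair U p q)
  then show ?case using raises_on_pair[of U w p q i w'] unmatched_subset[of i w U] by blast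
qed

text \<open>If only letters \<open>i\<close> are unmatched, a balanced counter is either
  \<open>0\<close> throughout, which raises all of them, or positive, which forces that none is
  left.\<close>

lemma raises_on_final:
  assumes U: "U \<subseteq> {..<length w}" and all: "\<forall>p\<in>U. w ! p = i"
  shows "raises_on i w U w' \<longleftrightarrow> w' = switch_letters i U w"
proof -
  have gen: "carry i c v \<le> c \<and> (carry i c v = c \<longrightarrow> c > 0 \<longrightarrow> raised i c v = v \<and> i \<notin> set v) \<and> 
       raised i 0 v = map (\<lambda>x. if x = i then Suc i else x) v \<and> carry i 0 v = 0" if "Suc i \<notin> set v" for c v
    using that
  proof (induction v arbitrary: c)
    case (Cons x v)
    have v: "Suc i \<notin> set v" "x \<noteq> Suc i" using Cons.prems by auto
    show ?case
    proof (cases "x = i")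
      case True
      then show ?thesis using Cons.IH[OF v(1), of "c - 1"] v by (cases c) auto
    next
      case False
      then show ?thesis using Cons.IH[OF v(1), of c] v by auto
    qed
  qed simp
  have S: "Suc i \<notin> set (masked i U w)"
    using U all by (auto simp: masked_def)
  have m: "masked i U (switch_letters i U w) = map (\<lambda>x. if x = i then Suc i else x) (masked i U w)"
    using all by (auto simp: masked_def switch_letters_def)
  have ex: "raised i 0 (masked i U w) = masked i U (switch_letters i U w) \<and> carry i 0 (masked i U w) = 0"
    using gen[OF S, of 0] m by simp
  have R: "raises_on i w U (switch_letters i U w)"
    unfolding raises_on_def
    by (intro conjI exI[of _ 0] ex) (auto simp: switch_letters_def)
  have eq: "w' = w''" if "raises_on i w U w'" "raises_on i w U w''"
    "masked i U w' = masked i U w''" for w' w''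
  proof (rule nth_equalityI)
    show "length w' = length w''" using that by (simp add: raises_on_def)
  next
    fix p assume p: "p < length w'"
    show "w' ! p = w'' ! p"
    proof (cases "p \<in> U")
      case True
      have "masked i U w' ! p = masked i U w'' ! p" using that by simp
      then show ?thesis using True p that(1,2) by (simp add: masked_def raises_on_def)
    next
      case False
      then show ?thesis using that(1,2) p by (simp add: raises_on_def)
    qed
  qed
  show ?thesis
  proof
    assume w': "raises_on i w U w'"
    then obtain c where c: "raised i c (masked i U w) = masked i U w'" "carry i c (masked i U w) = c"
      unfolding raises_on_def by blast
    have "raised i c (masked i U w) = raised i 0 (masked i U w)"
    proof (cases "c = 0")
      case False
      then have "raised i c (masked i U w) = masked i U w" "i \<notin> set (masked i U w)"
        using gen[OF S, of c] c by auto
      then show ?thesis by (simp add: raised_no_lower)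
    qed simp
    then show "w' = switch_letters i U w"
      using eq[OF w' R] c ex by simp
  qed (simp add: R)
qed

text \<open>Pairs matched before stage \<open>U\<close> lie outside \<open>V\<close>, so the same
  matching runs on the switched word. This reduces unmatched letters \<open>i + 1\<close> to
  unmatched letters \<open>i\<close>.\<close>

lemma unmatched_switch:
  assumes "unmatched i w U" "V \<subseteq> U"
  shows "unmatched i (switch_letters i V w) U"
  using assms
proof (induction rule: unmatched.induct)
  case start
  have "{p. p < length w \<and> w ! p \<in> {i, i + 1}} =
    {p. p < length (switch_letters i V w) \<and> switch_letters i V w ! p \<in> {i, i + 1}}"
    using start by (auto simp: switch_letters_def split: if_splits)
  then show ?case using unmatched.start[of i "switch_letters i V w"] by simp
next
  case (pair U p q)
  have "p < length w" "q < length w" using pair unmatched_subset by fastforce+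
  then have "switch_letters i V w ! p = i + 1" "switch_letters i V w ! q = i"
    using pair by (auto simp: switch_letters_def)
  then show ?case using pair by (intro unmatched.pair) auto
qed

lemma switch_switch:
  assumes "\<forall>p\<in>U. w ! p \<in> {i, i + 1}"
  shows "switch_letters i U (switch_letters i U w) = w"
  using assms by (intro nth_equalityI) (auto simp: switch_letters_def)

text \<open>A stage with the fewest unmatched positions is final: if both letters remained, an
  unmatched \<open>i + 1\<close> and an unmatched \<open>i\<close> at the least cyclic distance
  would have no unmatched letter between them and could be paired.\<close>

lemma unmatched_final_exists:
  "\<exists>U. unmatched i w U \<and> ((\<forall>p\<in>U. w ! p = i) \<or> (\<forall>p\<in>U. w ! p = i + 1))"
proof -
  obtain U where U: "unmatched i w U" and min: "\<And>V. unmatched i w V \<Longrightarrow> card U \<le> card V"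
    using ex_has_least_nat[of "unmatched i w", OF unmatched.start, of card] by blast
  have sub: "U \<subseteq> {p. p < length w \<and> w ! p \<in> {i, i + 1}}" using U by (rule unmatched_subset)
  have fin: "finite U" using sub by (rule finite_subset) simp
  show ?thesis
  proof (rule ccontr)
    assume "\<not> ?thesis"
    then obtain p0 q0 where p0: "p0 \<in> U" "w ! p0 = i + 1" "q0 \<in> U" "w ! q0 = i"
      using U sub by blast
    let ?d = "\<lambda>(p, q). if p < q then q - p else q + length w - p"
    let ?P = "\<lambda>x. fst x \<in> U \<and> w ! fst x = i + 1 \<and> snd x \<in> U \<and> w ! snd x = i"
    obtain x where x: "?P x" and least: "\<And>y. ?P y \<Longrightarrow> ?d x \<le> ?d y"
      using ex_has_least_nat[of ?P "(p0, q0)" ?d] p0 by auto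
    obtain p q where pq: "x = (p, q)" by fastforce
    have lt: "p < length w" "q < length w" using x pq sub by auto
    have "\<not> cyc_between p r q" if "r \<in> U" for r
    proof
      assume b: "cyc_between p r q"
      have r: "r < length w" using that sub by auto
      have "w ! r = i \<or> w ! r = i + 1" using that sub by auto
      then show False
      proof
        assume "w ! r = i"
        then have "?d x \<le> ?d (p, r)" using least[of "(p, r)"] x that pq by auto
        then show False using b lt r pq by (auto simp: cyc_between_def split: if_splits)
      next
        assume "w ! r = i + 1"
        then have "?d x \<le> ?d (r, q)" using least[of "(r, q)"] x that pq by auto
        then show False using b lt r pq by (auto simp: cyc_between_def split: if_splits)
      qed
    qed
    then have "unmatched i w (U - {p, q})" using x pq by (intro unmatched.pair[OF U]) auto
    then have "card U \<le> card (U - {p, q})" by (rule min)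
    moreover have "U - {p, q} \<subset> U" using x pq by auto
    ultimately show False using fin by (metis psubset_card_mono not_le)
  qed
qed

text \<open>The letters \<open>i\<close> that survive raising are exactly those that lower the
  counter. If the counter returns to its start, they are as many as the letters \<open>i + 1\<close>
  that increase it.\<close>

lemma fixed_carry_count:
  assumes "carry i c w = c"
  shows "count_list (raised i c w) i = count_list w (Suc i)"
    and "count_list (raised i c w) (Suc i) = count_list w i"
    and "count_list w (Suc i) \<le> count_list w i"
    and "count_list w (Suc i) = count_list w i \<Longrightarrow> raised i c w = w"
proof -
  have *: "c + count_list w (Suc i) = carry i c w + count_list (raised i c w) i
     \<and> count_list w i + count_list w (Suc i) = count_list (raised i c w) (Suc i) + count_list (raised i c w) i
     \<and> count_list (raised i c w) i \<le> count_list w i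
     \<and> (count_list (raised i c w) i = count_list w i \<longrightarrow> raised i c w = w)" for c
  proof (induction w arbitrary: c)
    case (Cons x w)
    show ?case
      using Cons[of "if x = Suc i then Suc c else if x = i then c - 1 else c"] by (auto split: if_splits)
  qed simp
  show "count_list (raised i c w) i = count_list w (Suc i)"
    "count_list (raised i c w) (Suc i) = count_list w i"
    "count_list w (Suc i) \<le> count_list w i"
    "count_list w (Suc i) = count_list w i \<Longrightarrow> raised i c w = w"
    using *[of c] assms by auto
qed

text \<open>A balanced word has at most as many letters \<open>i + 1\<close> as letters
  \<open>i\<close>, and raising exchanges the two numbers. If the result is balanced too, the
  numbers agree and nothing was raised.\<close>

lemma fixed_carry_raised:
  assumes "carry i c w = c" "carry i d (raised i c w) = d"
  shows "raised i c w = w"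
  using fixed_carry_count[OF assms(1)] fixed_carry_count[OF assms(2)] by auto

lemma s_word_eqI:
  assumes "\<And>U. \<lbrakk>unmatched i w U; (\<forall>p\<in>U. w ! p = i) \<or> (\<forall>p\<in>U. w ! p = i + 1)\<rbrakk>
    \<Longrightarrow> switch_letters i U w = w'"
  shows "s_word i w = w'"
  unfolding s_word_def
proof (rule the_equality)
  show "\<exists>U. unmatched i w U \<and> ((\<forall>p\<in>U. w ! p = i) \<or> (\<forall>p\<in>U. w ! p = i + 1)) \<and>
      w' = switch_letters i U w"
    using unmatched_final_exists[of i w] assms by metis
qed (use assms in metis)

lemma final_lower:
  assumes "unmatched i w U" "\<forall>p\<in>U. w ! p = i"
  shows "\<exists>c. raised i c w = switch_letters i U w \<and> carry i c w = c"
proof -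
  have "U \<subseteq> {..<length w}" using unmatched_subset[OF assms(1)] by auto
  then have "raises_on i w U (switch_letters i U w)"
    using raises_on_final assms(2) by simp
  then show ?thesis
    unfolding unmatched_raises_on[OF assms(1)] .
qed

text \<open>By \<open>unmatched_switch\<close>, \<open>U\<close> is also a stage for the switched
  word, where only letters \<open>i\<close> are unmatched; switching twice gives back
  \<open>w\<close>.\<close>

lemma final_upper:
  assumes "unmatched i w U" "\<forall>p\<in>U. w ! p = i + 1"
  shows "\<exists>c. raised i c (switch_letters i U w) = w \<and> carry i c (switch_letters i U w) = c"
proof -
  have "U \<subseteq> {..<length w}" using unmatched_subset[OF assms(1)] by auto
  then have "\<forall>p\<in>U. switch_letters i U w ! p = i"
    using assms(2) by (auto simp: switch_letters_def)
  from final_lower[OF unmatched_switch[OF assms(1) order_refl] this]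
  show ?thesis using assms(2) by (simp add: switch_switch)
qed

lemma s_word_raised:
  assumes "carry i c w = c"
  shows "s_word i w = raised i c w"
proof (rule s_word_eqI)
  fix U assume U: "unmatched i w U" "(\<forall>p\<in>U. w ! p = i) \<or> (\<forall>p\<in>U. w ! p = i + 1)"
  show "switch_letters i U w = raised i c w"
    using U(2)
  proof
    assume all: "\<forall>p\<in>U. w ! p = i"
    have "U \<subseteq> {..<length w}" using unmatched_subset[OF U(1)] by auto
    moreover have "raises_on i w U (raised i c w)"
      unfolding unmatched_raises_on[OF U(1)] using assms by blast
    ultimately show ?thesis
      using raises_on_final[of U w i "raised i c w"] all by simp
  next
    assume "\<forall>p\<in>U. w ! p = i + 1"
    from final_upper[OF U(1) this] obtain d where
      d: "raised i d (switch_letters i U w) = w" "carry i d (switch_letters i U w) = d" by blast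
    let ?v = "switch_letters i U w"
    \<comment> \<open>Here \<open>w\<close> is balanced and is itself the result of balanced
      raising, so neither raising changes anything.\<close>
    have "raised i d ?v = ?v"
      by (rule fixed_carry_raised[OF d(2), of c]) (simp add: d(1) assms)
    then have v: "?v = w" using d(1) by simp
    have "raised i c w = w"
    proof (rule fixed_carry_count(4)[OF assms])
      show "count_list w (Suc i) = count_list w i"
        using fixed_carry_count(1)[OF d(2)] d(1) v by simp
    qed
    with v show ?thesis by simp
  qed
qed

text \<open>If only letters \<open>i\<close> are unmatched, the raised word is balanced as well and
  equals \<open>w\<close>. Otherwise the switched word is a balanced preimage, and
  \<open>raised_fixed_unique\<close> identifies it with \<open>w\<close>.\<close>

lemma s_word_of_raised:
  assumes "carry i c w = c"
  shows "s_word i (raised i c w) = w"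
proof (rule s_word_eqI)
  let ?v = "raised i c w"
  fix U assume U: "unmatched i ?v U" "(\<forall>p\<in>U. ?v ! p = i) \<or> (\<forall>p\<in>U. ?v ! p = i + 1)"
  show "switch_letters i U ?v = w"
    using U(2)
  proof
    assume "\<forall>p\<in>U. ?v ! p = i"
    from final_lower[OF U(1) this] obtain d where
      d: "raised i d ?v = switch_letters i U ?v" "carry i d ?v = d" by blast
    have "?v = w" using fixed_carry_raised[OF assms d(2)] .
    moreover have "raised i d w = w"
    proof (rule fixed_carry_count(4))
      show "carry i d w = d" using d(2) \<open>?v = w\<close> by simp
      show "count_list w (Suc i) = count_list w i"
        using fixed_carry_count(1)[OF assms] \<open>?v = w\<close> by simp
    qed
    ultimately show ?thesis using d(1) by simp
  next
    assume "\<forall>p\<in>U. ?v ! p = i + 1"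
    from final_upper[OF U(1) this] show ?thesis
      using raised_fixed_unique[of i _ "switch_letters i U ?v" c w] assms by blast
  qed
qed

text \<open>The letter left unmatched decides between the cases. Later statements thus reduce to
  balanced words, on which \<open>s_word\<close> is raising, and their raised images, on which it is
  the inverse.\<close>

lemma fixed_carry_cases:
  obtains c where "carry i c w = c" | c v where "carry i c v = c" "w = raised i c v"
proof -
  obtain U where U: "unmatched i w U" and "(\<forall>p\<in>U. w ! p = i) \<or> (\<forall>p\<in>U. w ! p = i + 1)"
    using unmatched_final_exists by blast
  from this(2) show ?thesis
  proof
    assume "\<forall>p\<in>U. w ! p = i"
    then show ?thesis using final_lower[OF U] that(1) by blast
  next
    assume "\<forall>p\<in>U. w ! p = i + 1"
    then show ?thesis using final_upper[OF U] that(2) by metis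
  qed
qed

section \<open>Row insertion commutes with raising\<close>

text \<open>Since \<open>tl [] = []\<close> and \<open>take 1 [] = []\<close>, these also cover the case that \<open>x\<close> is appended and
  nothing is bumped.\<close>

definition row_put :: "nat list \<Rightarrow> nat \<Rightarrow> nat list" where
  "row_put r x = takeWhile (\<lambda>y. y \<le> x) r @ x # tl (dropWhile (\<lambda>y. y \<le> x) r)"

definition row_out :: "nat list \<Rightarrow> nat \<Rightarrow> nat list" where
  "row_out r x = take 1 (dropWhile (\<lambda>y. y \<le> x) r)"

primrec bumped :: "nat list \<Rightarrow> nat list \<Rightarrow> nat list" where
  "bumped r [] = []"
| "bumped r (x # w) = row_out r x @ bumped (row_put r x) w"

text \<open>Enough to process insertion row by row; no relation between different rows is
  required.\<close>

definition rows_ok :: "tableau \<Rightarrow> bool" where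
  "rows_ok T \<longleftrightarrow> (\<forall>r\<in>set T. r \<noteq> [] \<and> sorted r)"

lemma rows_ok_simps [simp]:
  "rows_ok []" "rows_ok (r # T) \<longleftrightarrow> r \<noteq> [] \<and> sorted r \<and> rows_ok T"
  "rows_ok (S @ T) \<longleftrightarrow> rows_ok S \<and> rows_ok T"
  by (auto simp: rows_ok_def)

lemma row_append:
  assumes "\<forall>e\<in>set r. e \<le> x"
  shows "row_put r x = r @ [x]" "row_out r x = []"
proof -
  have *: "takeWhile (\<lambda>y. y \<le> x) r = r" "dropWhile (\<lambda>y. y \<le> x) r = []"
    using assms by auto
  then show "row_put r x = r @ [x]" "row_out r x = []"
    by (simp_all add: row_put_def row_out_def *)
qed

lemma row_bump:
  assumes "\<forall>e\<in>set p. e \<le> x" "x < y"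
  shows "row_put (p @ y # q) x = p @ x # q" "row_out (p @ y # q) x = [y]"
proof -
  have "takeWhile (\<lambda>y. y \<le> x) (p @ y # q) = p" "dropWhile (\<lambda>y. y \<le> x) (p @ y # q) = y # q"
    using assms by (simp_all add: takeWhile_append dropWhile_append)
  then show "row_put (p @ y # q) x = p @ x # q" "row_out (p @ y # q) x = [y]"
    by (simp_all add: row_put_def row_out_def)
qed

lemma row_cases:
  obtains "\<forall>e\<in>set r. e \<le> x" | p y q where "r = p @ y # q" "\<forall>e\<in>set p. e \<le> x" "x < (y :: nat)"
proof (cases "\<forall>e\<in>set r. e \<le> x")
  case False
  then have "\<exists>e\<in>set r. x < e" by (simp add: not_le)
  from split_list_first_prop[OF this] show ?thesis using that(2) by (auto simp: not_less)
qed (rule that(1))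

lemma row_put_not_Nil [simp]: "row_put r x \<noteq> []"
  by (simp add: row_put_def)

lemma sorted_row_put: "sorted r \<Longrightarrow> sorted (row_put r x)"
  by (rule row_cases[of r x]) (auto simp: row_append row_bump sorted_append)

lemma set_row_put: "set (row_put r x) \<subseteq> insert x (set r)"
  by (rule row_cases[of r x]) (auto simp: row_append row_bump)

lemma set_row_out: "set (row_out r x) \<subseteq> {e\<in>set r. x < e}"
  by (rule row_cases[of r x]) (auto simp: row_append row_bump)

lemma insert_word_Nil [simp]: "insert_word T [] = T"
  by (simp add: insert_word_def)

lemma insert_word_Cons: "insert_word T (x # w) = insert_word (schensted_insert T x) w"
  by (simp add: insert_word_def)

lemma insert_word_append: "insert_word T (u @ v) = insert_word (insert_word T u) v"
  by (simp add: insert_word_def)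

lemma schensted_insert_Nil [simp]: "schensted_insert [] x = [[x]]"
  by (simp add: schensted_insert_def)

text \<open>Insertion compares \<open>x\<close> with the last letter only, which in a sorted row
  decides whether any letter exceeds \<open>x\<close>. As \<open>row_out r x\<close> has at most one
  letter, one formula covers appending and bumping.\<close>

lemma schensted_insert_snoc:
  assumes "r \<noteq> []" "sorted r"
  shows "schensted_insert (T @ [r]) x = insert_word T (row_out r x) @ [row_put r x]"
proof (rule row_cases[of r x])
  assume "\<forall>e\<in>set r. e \<le> x"
  then show ?thesis using assms row_append[of r x] by (simp add: schensted_insert_def)
next
  fix p y q assume r: "r = p @ y # q" "\<forall>e\<in>set p. e \<le> x" "x < y"
  then have "y \<le> last r" using assms(2) by (auto simp: sorted_append)
  then have "x < last r" using r(3) by simp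
  then show ?thesis
    using r row_bump[OF r(2,3), of q]
    by (simp add: schensted_insert_def insert_word_Cons takeWhile_append dropWhile_append)
qed

text \<open>The rows above see only the letters leaving the bottom row, in the order of leaving, so
  the whole word can pass through the bottom row first.\<close>

lemma insert_word_snoc:
  assumes "r \<noteq> []" "sorted r"
  shows "insert_word (T @ [r]) w = insert_word T (bumped r w) @ [foldl row_put r w]"
  using assms
proof (induction w arbitrary: T r)
  case (Cons x w)
  then show ?case
    using Cons.IH[of "row_put r x"] sorted_row_put[of r x]
    by (simp add: insert_word_Cons schensted_insert_snoc insert_word_append)
qed simp

lemma insert_word_empty:
  "w \<noteq> [] \<Longrightarrow> insert_word [] w = insert_word [] (bumped [] w) @ [foldl row_put [] w]"
proof (cases w)
  case (Cons x v)
  then show ?thesis using insert_word_snoc[of "[x]" "[]" v] row_append[of "[]" x]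
    by (simp add: insert_word_Cons)
qed simp

lemma rows_ok_schensted_insert: "rows_ok T \<Longrightarrow> rows_ok (schensted_insert T x)"
proof (induction T arbitrary: x rule: rev_induct)
  case Nil
  then show ?case by simp
next
  case (snoc r T)
  have r: "r \<noteq> []" "sorted r" and T: "rows_ok T" using snoc.prems by simp_all
  have "rows_ok (insert_word T (row_out r x))"
  proof (rule row_cases[of r x])
    assume "\<forall>e\<in>set r. e \<le> x"
    then have "row_out r x = []" by (rule row_append)
    then show ?thesis using T by simp
  next
    fix p y q assume "r = p @ y # q" "\<forall>e\<in>set p. e \<le> x" "x < y"
    then have "row_out r x = [y]" using row_bump by blast
    then show ?thesis using snoc.IH[OF T, of y] by (simp add: insert_word_Cons)
  qed
  then show ?case
    by (simp add: schensted_insert_snoc[OF r] sorted_row_put[OF r(2)])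
qed

lemma rows_ok_insert_word: "rows_ok T \<Longrightarrow> rows_ok (insert_word T w)"
  by (induction w arbitrary: T) (simp_all add: insert_word_Cons rows_ok_schensted_insert)

section \<open>Raising a tableau along its row reading\<close>

primrec raise_tableau :: "nat \<Rightarrow> nat \<Rightarrow> tableau \<Rightarrow> tableau" where
  "raise_tableau i c [] = []"
| "raise_tableau i c (r # T) = raised i c r # raise_tableau i (carry i c r) T"

lemma raise_tableau_append [simp]:
  "raise_tableau i c (S @ T) = raise_tableau i c S @ raise_tableau i (carry i c (concat S)) T"
  by (induction S arbitrary: c) simp_all

lemma concat_raise_tableau [simp]: "concat (raise_tableau i c T) = raised i c (concat T)"
  by (induction T arbitrary: c) simp_all

lemma length_raise_tableau [simp]: "length (raise_tableau i c T) = length T"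
  by (induction T arbitrary: c) simp_all

lemma raised_lower_bound: "\<forall>e\<in>set w. m \<le> e \<Longrightarrow> e \<in> set (raised i c w) \<Longrightarrow> m \<le> e"
  by (induction w arbitrary: c) (auto split: if_splits)

lemma raised_upper_bound:
  "\<forall>e\<in>set w. e \<le> m \<Longrightarrow> Suc i \<le> m \<Longrightarrow> e \<in> set (raised i c w) \<Longrightarrow> e \<le> m"
  by (induction w arbitrary: c) (auto split: if_splits)

text \<open>In a sorted word every \<open>i\<close> precedes every \<open>i + 1\<close>, so once an
  \<open>i\<close> is raised at counter \<open>0\<close>, all later letters \<open>i\<close> are
  raised too.\<close>

lemma sorted_raised: "sorted w \<Longrightarrow> sorted (raised i c w)"
proof (induction w arbitrary: c)
  case (Cons x w)
  have low: "\<forall>e\<in>set (raised i c' w). x \<le> e" for c'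
    using raised_lower_bound[of w x] Cons.prems by auto
  have gt: "\<forall>e\<in>set (raised i 0 v). Suc i \<le> e" if "sorted v" "\<forall>e\<in>set v. i \<le> e" for v
    using that
  proof (induction v)
    case (Cons y v)
    show ?case
    proof (cases "y = i")
      case True
      then show ?thesis using Cons by auto
    next
      case False
      then have "\<forall>e\<in>set v. Suc i \<le> e" using Cons.prems by auto
      then show ?thesis using False Cons.prems raised_lower_bound[of v "Suc i"] by auto
    qed
  qed simp
  show ?case
  proof (cases "x = i \<and> c = 0")
    case True
    then show ?thesis using Cons.IH[of 0] Cons.prems gt[of w] by simp
  next
    case False
    then show ?thesis using Cons.IH Cons.prems low by auto
  qed
qed simp

text \<open>Bumping rewrites \<open>p y q x\<close> as \<open>y p x q\<close>. If
  \<open>x < i\<close>, the counter ignores \<open>p\<close> and \<open>x\<close>; if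
  \<open>y > i + 1\<close>, it ignores \<open>y\<close> and \<open>q\<close>. In both cases the
  letters it sees keep their order. Only for \<open>x = i\<close> and \<open>y = i + 1\<close> does
  an \<open>i + 1\<close> move past letters \<open>i\<close>, and then the raised row may be bumped
  further left.\<close>

lemma carry_raised_bump:
  assumes p: "\<forall>e\<in>set p. e \<le> x" and "x < y" and "sorted (p @ y # q)"
    and x': "raised i (carry i c (p @ y # q)) [x] = [x']"
  shows "\<exists>p' y' q'. raised i c (p @ y # q) = p' @ y' # q' \<and> (\<forall>e\<in>set p'. e \<le> x') \<and> x' < y' \<and>
    raised i c (y # p @ x # q) = y' # p' @ x' # q' \<and>
    carry i c (y # p @ x # q) = carry i c (p @ y # q @ [x])"
proof -
  have q: "\<forall>e\<in>set q. y \<le> e" and sp: "sorted p" using assms(3) by (auto simp: sorted_append)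
  consider "x < i" | "Suc i \<le> x" | "x = i" "Suc i < y" | "x = i" "y = Suc i"
    using assms(2) by linarith
  then show ?thesis
  proof cases
    case 1
    have n: "i \<notin> set p" "Suc i \<notin> set p" using 1 p by auto
    have "x' = x" using x' 1 by auto
    have 1: "raised i c (p @ y # q) = p @ hd (raised i c [y]) # raised i (carry i c [y]) q"
      by (simp add: carry_neutral[OF n] raised_no_lower[OF n(1)])
    have 2: "raised i c (y # p @ x # q) = hd (raised i c [y]) # p @ x # raised i (carry i c [y]) q"
      using \<open>x < i\<close> by (simp add: carry_neutral[OF n] raised_no_lower[OF n(1)])
    have 3: "x < hd (raised i c [y])" using assms(2) by auto
    have 4: "carry i c (y # p @ x # q) = carry i c (p @ y # q @ [x])"
      using \<open>x < i\<close> by (simp add: carry_neutral[OF n])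
    show ?thesis
      unfolding \<open>x' = x\<close> using 1 p 3 2 4 by (intro exI conjI)
  next
    case 2
    have n: "i \<notin> set (y # q)" "Suc i \<notin> set (y # q)" using 2 assms(2) q by auto
    have nq: "i \<notin> set q" "Suc i \<notin> set q" using n by auto
    have "x' = x" using x' 2 by auto
    have 1: "raised i c (p @ y # q) = raised i c p @ y # q"
      by (simp only: raised_append raised_no_lower[OF n(1)])
    have 3: "\<forall>e\<in>set (raised i c p). e \<le> x"
      using raised_upper_bound[OF p 2] by blast
    have 4: "raised i c (y # p @ x # q) = y # raised i c p @ x # q"
      using 2 n by (simp add: raised_no_lower[OF nq(1)])
    have 5: "carry i c (y # p @ x # q) = carry i c (p @ y # q @ [x])"
      using 2 n by (simp add: carry_neutral[OF nq])
    show ?thesis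
      unfolding \<open>x' = x\<close> using 1 3 assms(2) 4 5 by (intro exI conjI)
  next
    case 3
    have n: "i \<notin> set (y # q)" "Suc i \<notin> set (y # q)" using 3 assms(2) q by auto
    have nq: "i \<notin> set q" "Suc i \<notin> set q" using n by auto
    let ?c = "carry i c p"
    have x': "x' = (if ?c = 0 then Suc i else i)"
      using x' 3 n by (simp add: carry_neutral[OF nq] split: if_splits)
    \<comment> \<open>A counter that is positive after a word without \<open>i + 1\<close> was
      positive all along, so no \<open>i\<close> was raised.\<close>
    have noraise: "?c > 0 \<Longrightarrow> Suc i \<notin> set p \<Longrightarrow> raised i c p = p"
    proof (induction p arbitrary: c)
      case (Cons e p)
      have "carry i 0 p = 0" if "Suc i \<notin> set p" for p
        using that by (induction p) auto
      then show ?case using Cons by (cases c) (auto split: if_splits)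
    qed simp
    have 1: "raised i c (p @ y # q) = raised i c p @ y # q"
      by (simp only: raised_append raised_no_lower[OF n(1)])
    have 2: "\<forall>e\<in>set (raised i c p). e \<le> x'"
    proof (cases "?c = 0")
      case True
      then show ?thesis using raised_upper_bound[of p "Suc i" i] p 3 x' by fastforce
    next
      case False
      have "Suc i \<notin> set p" using p 3 by auto
      then show ?thesis using noraise False x' p 3 by simp
    qed
    have 5: "raised i c (y # p @ x # q) = y # raised i c p @ x' # q"
      using 3 n x' by (simp add: raised_no_lower[OF nq(1)])
    have 6: "carry i c (y # p @ x # q) = carry i c (p @ y # q @ [x])"
      using 3 n by (simp add: carry_neutral[OF nq])
    have "x' < y" using x' 3 by auto
    with 1 2 show ?thesis using 5 6 by (intro exI conjI)
  next
    case 4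
    define P a where "P = filter (\<lambda>e. e < i) p" and "a = length (filter (\<lambda>e. e = i) p)"
    have pa: "p = P @ replicate a i" 
      using p sp unfolding P_def a_def \<open>x = i\<close>
    proof (induction p)
      case (Cons e p)
      then show ?case
      proof (cases "e = i")
        case True
        then have "filter (\<lambda>e. e < i) p = []" using Cons.prems by (auto simp: filter_empty_conv)
        then show ?thesis using Cons True by auto
      qed auto
    qed simp
    have nP: "i \<notin> set P" "Suc i \<notin> set P" by (auto simp: P_def)
    have nq: "i \<notin> set q" using q 4 by auto
    have rr: "raised i c (replicate a i) = replicate (min c a) i @ replicate (a - c) (Suc i)"
      "carry i c (replicate a i) = c - a" for c a
    proof (induction a arbitrary: c)
      case (Suc a)
      { case 1 then show ?case using Suc.IH(1)[of "c - 1"] by (cases c) auto }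
      { case 2 then show ?case using Suc.IH(2)[of "c - 1"] by (cases c) auto }
    qed simp_all
    have cq: "carry i k q \<ge> k" for k
      using nq by (induction q arbitrary: k) (auto intro: Suc_leD)
    have cq1: "carry i (Suc k) q = Suc (carry i k q)" for k
      using nq by (induction q arbitrary: k) auto
    have "x' = i" using x' cq[of "Suc (carry i c p)"] 4 by (auto split: if_splits)
    \<comment> \<open>The last \<open>a - c\<close> of the letters \<open>i\<close> closing
      \<open>p\<close> are raised. The bumped letter is then the first \<open>Suc i\<close> after
      the unraised ones, so \<open>q'\<close> starts with \<open>a - c\<close> letters
      \<open>Suc i\<close>.\<close>
    define p' q' where "p' = P @ replicate (min c a) i" and "q' = replicate (a - c) (Suc i) @ q"
    have "raised i c (p @ y # q) = p' @ y # q'"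
      using 4 nP nq by (simp add: pa p'_def q'_def rr raised_no_lower carry_neutral
        replicate_app_Cons_same)
    moreover have "\<forall>e\<in>set p'. e \<le> x'"
      using \<open>x' = i\<close> by (auto simp: p'_def P_def)
    moreover have e: "y # p @ x # q = y # P @ replicate (Suc a) i @ q"
      using 4 by (simp add: pa replicate_app_Cons_same)
    have "raised i c (y # p @ x # q) = y # p' @ x' # q'"
      unfolding e using 4 nP nq \<open>x' = i\<close>
      by (simp add: p'_def q'_def rr raised_no_lower carry_neutral del: replicate.simps)
        (simp add: replicate_app_Cons_same)
    moreover have "carry i c (y # p @ x # q) = carry i c (p @ y # q @ [x])"
      unfolding e using 4 nP
      by (simp add: pa rr carry_neutral cq1 del: replicate.simps)
    ultimately show ?thesis using 4 \<open>x' = i\<close> by (intro exI[of _ p'] exI[of _ y] exI[of _ q']) simp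
  qed
qed

text \<open>Bumping is \<open>carry_raised_bump\<close>. For appending, raising keeps
  \<open>r @ [x]\<close> sorted, so \<open>x'\<close> is appended as well.\<close>

lemma row_raised:
  assumes "sorted r" and x': "raised i (carry i c r) [x] = [x']"
  shows "raised i c (row_out r x) = row_out (raised i c r) x'"
    and "raised i (carry i c (row_out r x)) (row_put r x) = row_put (raised i c r) x'"
    and "carry i c (row_out r x @ row_put r x) = carry i c (r @ [x])"
proof -
  have "raised i c (row_out r x) = row_out (raised i c r) x' \<and>
     raised i (carry i c (row_out r x)) (row_put r x) = row_put (raised i c r) x' \<and>
     carry i c (row_out r x @ row_put r x) = carry i c (r @ [x])"
  proof (rule row_cases[of r x])
    assume r: "\<forall>e\<in>set r. e \<le> x"
    then have "sorted (r @ [x])" using assms(1) by (simp add: sorted_append)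
    then have "sorted (raised i c r @ [x'])"
      using sorted_raised[of "r @ [x]" i c] x' by simp
    then have "\<forall>e\<in>set (raised i c r). e \<le> x'" by (simp add: sorted_append)
    then show ?thesis using r x' by (simp add: row_append)
  next
    fix p y q assume r: "r = p @ y # q" "\<forall>e\<in>set p. e \<le> x" "x < y"
    obtain p' y' q' where *: "raised i c (p @ y # q) = p' @ y' # q'" "\<forall>e\<in>set p'. e \<le> x'" "x' < y'"
      "raised i c (y # p @ x # q) = y' # p' @ x' # q'"
      "carry i c (y # p @ x # q) = carry i c (p @ y # q @ [x])"
      using carry_raised_bump[OF r(2,3)] assms r(1) by blast
    have "raised i c r = p' @ y' # q'" using * r by simp
    moreover have "raised i c [y] = [y']"
      "raised i (carry i c [y]) (p @ x # q) = p' @ x' # q'" using *(4) by auto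
    ultimately show ?thesis using *(2,3,5) r(2,3) row_bump[OF r(2,3), of q] row_bump[OF *(2,3), of q']
      by (simp add: r(1) del: carry.simps raised.simps)
  qed
  then show "raised i c (row_out r x) = row_out (raised i c r) x'"
    "raised i (carry i c (row_out r x)) (row_put r x) = row_put (raised i c r) x'"
    "carry i c (row_out r x @ row_put r x) = carry i c (r @ [x])" by auto
qed

text \<open>The bottom row passes its bumped letter to the front, where it is met at the counter
  value reached after \<open>T\<close>. This is the situation of the induction hypothesis.\<close>

lemma raise_schensted_insert:
  assumes "rows_ok T" "raised i (carry i c (concat T)) [x] = [x']"
  shows "schensted_insert (raise_tableau i c T) x' = raise_tableau i c (schensted_insert T x) \<and>
    carry i c (concat (schensted_insert T x)) = carry i c (concat T @ [x])"
  using assms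
proof (induction T arbitrary: x x' rule: rev_induct)
  case Nil
  then show ?case by simp
next
  case (snoc r T)
  let ?d = "carry i c (concat T)"
  have r: "r \<noteq> []" "sorted r" and T: "rows_ok T" using snoc.prems by simp_all
  have x': "raised i (carry i ?d r) [x] = [x']" using snoc.prems(2) by simp
  note row = row_raised[OF r(2) x']
  have r': "raised i ?d r \<noteq> []" "sorted (raised i ?d r)"
    using r sorted_raised[OF r(2)] length_raised[of i ?d r] by (auto simp del: length_raised)
  have rest: "insert_word (raise_tableau i c T) (row_out (raised i ?d r) x') =
      raise_tableau i c (insert_word T (row_out r x)) \<and>
      carry i c (concat (insert_word T (row_out r x))) = carry i c (concat T @ row_out r x)"
  proof (rule row_cases[of r x])
    assume "\<forall>e\<in>set r. e \<le> x"
    then have "row_out r x = []" by (rule row_append)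
    then show ?thesis using row(1) by simp
  next
    fix p y q assume "r = p @ y # q" "\<forall>e\<in>set p. e \<le> x" "x < y"
    then have out: "row_out r x = [y]" using row_bump by blast
    obtain y' where y': "raised i ?d [y] = [y']" by simp
    have "row_out (raised i ?d r) x' = [y']" using row(1) y' unfolding out by simp
    then show ?thesis using snoc.IH[OF T y'] by (simp add: out insert_word_Cons)
  qed
  show ?case
    using rest row r r'
    by (simp add: schensted_insert_snoc del: raised.simps)
qed

lemma raise_insert_word:
  assumes "rows_ok T"
  shows "insert_word (raise_tableau i c T) (raised i (carry i c (concat T)) w) =
      raise_tableau i c (insert_word T w)"
    and "carry i c (concat (insert_word T w)) = carry i c (concat T @ w)"
proof -
  have "insert_word (raise_tableau i c T) (raised i (carry i c (concat T)) w) =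
      raise_tableau i c (insert_word T w) \<and>
    carry i c (concat (insert_word T w)) = carry i c (concat T @ w)"
    using assms
  proof (induction w arbitrary: T)
    case (Cons x w)
    let ?d = "carry i c (concat T)"
    obtain x' where x': "raised i ?d [x] = [x']" by simp
    have w: "raised i ?d (x # w) = x' # raised i (carry i ?d [x]) w" using x' by auto
    show ?case
      unfolding w insert_word_Cons
      using raise_schensted_insert[OF Cons.prems x'] Cons.IH[OF rows_ok_schensted_insert[OF Cons.prems], of x]
      by simp
  qed simp
  then show "insert_word (raise_tableau i c T) (raised i (carry i c (concat T)) w) =
      raise_tableau i c (insert_word T w)"
    "carry i c (concat (insert_word T w)) = carry i c (concat T @ w)" by auto
qed

section \<open>Tableaux\<close>

lemma YT_Nil [simp]: "[] \<in> YT n"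
  by (simp add: YT_def)

lemma YT_append_iff: "S @ T \<in> YT n \<longleftrightarrow> S \<in> YT n \<and> T \<in> YT n \<and>
    (S = [] \<or> T = [] \<or> dominates_row (last S) (hd T))"
  by (auto simp: YT_def successively_append_iff)

lemma YT_single_iff: "[r] \<in> YT n \<longleftrightarrow> r \<noteq> [] \<and> sorted r \<and> set r \<subseteq> {1..n}"
  by (simp add: YT_def)

lemma YT_rows_ok: "T \<in> YT n \<Longrightarrow> rows_ok T"
  by (simp add: YT_def rows_ok_def)

lemma YT_letters: "T \<in> YT n \<Longrightarrow> set (concat T) \<subseteq> {1..n}"
  by (auto simp: YT_def)

text \<open>The bumped \<open>y\<close> lands in \<open>s\<close> no further right than column
  \<open>length p\<close>, because an entry of \<open>s\<close> in that column exceeds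
  \<open>y\<close>. Up to there the lower row now holds letters below \<open>y\<close>.\<close>

lemma dominates_row_bump:
  assumes d: "dominates_row s (p @ y # q)" and p: "\<forall>e\<in>set p. e \<le> x" and "x < y"
  shows "dominates_row (row_put s y) (p @ x # q)"
proof -
  have len: "length s \<le> length p + Suc (length q)"
    and gt: "\<And>m. m < length s \<Longrightarrow> s ! m > (p @ y # q) ! m"
    using d by (auto simp: dominates_row_def)
  have low: "(p @ x # q) ! m < y" if "m \<le> length p" for m
    using that p \<open>x < y\<close> by (auto simp: nth_append dest!: nth_mem intro: le_less_trans)
  have le: "(p @ x # q) ! m \<le> (p @ y # q) ! m" for m
    using \<open>x < y\<close> by (cases "m = length p") (simp_all add: nth_append nth_Cons split: nat.split)
  show ?thesis
  proof (rule row_cases[of s y])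
    assume s: "\<forall>e\<in>set s. e \<le> y"
    have "length s \<le> length p"
    proof (rule ccontr)
      assume "\<not> length s \<le> length p"
      then have "length p < length s" by simp
      then have "s ! length p > y" "s ! length p \<in> set s" using gt[of "length p"] by auto
      then show False using s by auto
    qed
    then show ?thesis
      unfolding row_append[OF s] dominates_row_def
      using gt low le by (auto simp: nth_append[of s] less_Suc_eq intro: le_less_trans[OF le])
  next
    fix p' z q' assume s: "s = p' @ z # q'" "\<forall>e\<in>set p'. e \<le> y" "y < z"
    have "length p' \<le> length p"
    proof (rule ccontr)
      assume "\<not> length p' \<le> length p"
      then have "length p < length p'" by simp
      then have "s ! length p > y" "s ! length p \<in> set p'" using gt[of "length p"] s(1)
        by (auto simp: nth_append)
      then show False using s(2) by auto
    qed
    moreover have "(p' @ y # q') ! m = s ! m" if "m \<noteq> length p'" for m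
      using that s(1) by (auto simp: nth_append nth_Cons split: nat.split)
    ultimately have "(p' @ y # q') ! m > (p @ x # q) ! m" if "m < length s" for m
      using gt[OF that] low[of m] le[of m] by (cases "m = length p'") auto
    then show ?thesis
      unfolding s(1) row_bump[OF s(2,3)] dominates_row_def using len s(1) by simp
  qed
qed

lemma schensted_insert_YT:
  assumes "T \<in> YT n" "x \<in> {1..n}"
  shows "schensted_insert T x \<in> YT n"
  using assms
proof (induction T arbitrary: x rule: rev_induct)
  case Nil
  then show ?case by (simp add: YT_single_iff)
next
  case (snoc r T)
  have T: "T \<in> YT n" and r: "r \<noteq> []" "sorted r" "set r \<subseteq> {1..n}"
    and dom: "T = [] \<or> dominates_row (last T) r"
    using snoc.prems(1) by (auto simp: YT_append_iff YT_single_iff)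
  have put: "[row_put r x] \<in> YT n"
    using sorted_row_put[OF r(2)] set_row_put[of r x] r(3) snoc.prems(2) by (auto simp: YT_single_iff)
  show ?case
  proof (rule row_cases[of r x])
    assume x: "\<forall>e\<in>set r. e \<le> x"
    have "T = [] \<or> dominates_row (last T) (r @ [x])"
      using dom by (auto simp: dominates_row_def nth_append)
    then show ?thesis using put T
      unfolding schensted_insert_snoc[OF r(1,2)] row_append[OF x]
      by (auto simp: YT_append_iff)
  next
    fix p y q assume y: "r = p @ y # q" "\<forall>e\<in>set p. e \<le> x" "x < y"
    have "y \<in> {1..n}" using r(3) y(1) by auto
    then have ins: "schensted_insert T y \<in> YT n" by (rule snoc.IH[OF T])
    have "dominates_row (last (schensted_insert T y)) (p @ x # q)"
    proof (cases T rule: rev_cases)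
      case Nil
      \<comment> \<open>Without a row above, \<open>y\<close> forms a new top row of length one, and
        the row below it starts with a letter at most \<open>x\<close>.\<close>
      then show ?thesis using y(2,3) by (cases p) (auto simp: dominates_row_def)
    next
      case (snoc T' s)
      then have s: "s \<noteq> []" "sorted s" using T by (auto simp: YT_append_iff YT_single_iff)
      have "dominates_row s (p @ y # q)" using dom snoc y(1) by simp
      then show ?thesis using dominates_row_bump y(2,3) unfolding snoc
        by (simp add: schensted_insert_snoc[OF s])
    qed
    moreover have "row_put r x = p @ x # q" "row_out r x = [y]"
      unfolding y(1) by (rule row_bump[OF y(2,3)])+
    ultimately show ?thesis using put ins
      by (simp add: schensted_insert_snoc[OF r(1,2)] insert_word_Cons YT_append_iff)
  qed
qed

lemma insert_word_YT: "T \<in> YT n \<Longrightarrow> set w \<subseteq> {1..n} \<Longrightarrow> insert_word T w \<in> YT n"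
proof (induction w arbitrary: T)
  case (Cons x w)
  then show ?case using schensted_insert_YT[of T n x] by (simp add: insert_word_Cons)
qed simp

text \<open>Each letter of \<open>w\<close> bumps the letter of \<open>v\<close> above it, if there
  is one. The prefix \<open>u\<close> collects the letters already inserted, which later letters
  leave in place.\<close>

lemma insert_dominated_row:
  assumes "sorted w" "sorted v" "length v \<le> length w" "\<forall>m<length v. v ! m > w ! m"
    "\<forall>e\<in>set u. \<forall>x\<in>set w. e \<le> x"
  shows "bumped (u @ v) w = v \<and> foldl row_put (u @ v) w = u @ w"
  using assms
proof (induction w arbitrary: u v)
  case (Cons x w)
  have u: "\<forall>e\<in>set u. e \<le> x" using Cons.prems by auto
  have ux: "\<forall>e\<in>set (u @ [x]). \<forall>x\<in>set w. e \<le> x" using Cons.prems by auto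
  have w: "sorted w" using Cons.prems by simp
  show ?case
  proof (cases v)
    case Nil
    then show ?thesis using Cons.IH[OF w, of "[]" "u @ [x]"] ux row_append[OF u] by simp
  next
    case (Cons y v')
    have "x < y" using Cons.prems(4) Cons by auto
    moreover have "\<forall>m<length v'. v' ! m > w ! m" using Cons.prems(4) unfolding Cons by auto
    moreover have "sorted v'" "length v' \<le> length w" using Cons.prems Cons by auto
    ultimately show ?thesis
      using Cons.IH[OF w, of v' "u @ [x]"] ux row_bump[OF u \<open>x < y\<close>, of v'] Cons by simp
  qed
qed simp

text \<open>The new row takes the place of the bottom row and pushes it up as a whole, and so on
  through all rows.\<close>

lemma insert_word_new_row:
  assumes "T @ [r] \<in> YT n"
  shows "insert_word T r = T @ [r]"
  using assms
proof (induction T arbitrary: r rule: rev_induct)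
  case Nil
  then have r: "r \<noteq> []" "sorted r" by (auto simp: YT_single_iff)
  then show ?case using insert_dominated_row[of r "[]" "[]"] insert_word_empty[of r] by simp
next
  case (snoc s T)
  have r: "sorted r" and s: "s \<noteq> []" "sorted s" and d: "dominates_row s r" and T: "T @ [s] \<in> YT n"
    using snoc.prems unfolding YT_append_iff[of "T @ [s]"]
    by (auto simp: YT_single_iff YT_append_iff[of T])
  show ?case
    using insert_dominated_row[of r s "[]"] r s d snoc.IH[OF T]
    by (simp add: insert_word_snoc[OF s] dominates_row_def)
qed

lemma tableau_of_reading: "T \<in> YT n \<Longrightarrow> tableau_of (concat T) = T"
proof (induction T rule: rev_induct)
  case (snoc r T)
  have "T \<in> YT n" using snoc.prems by (simp add: YT_append_iff)
  then show ?case using snoc.IH insert_word_new_row[OF snoc.prems]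
    by (simp add: tableau_of_def insert_word_append)
qed (simp add: tableau_of_def)

section \<open>Bounds on the numbers of rows and columns of a product\<close>

lemma sorted_bumped:
  "sorted r \<Longrightarrow> sorted w \<Longrightarrow> sorted (bumped r w) \<and> (\<forall>m. (\<forall>x\<in>set w. m \<le> x) \<longrightarrow> set (bumped r w) \<subseteq> {e\<in>set r. m < e})"
proof (induction w arbitrary: r)
  case (Cons x w)
  have w: "sorted w" "\<forall>e\<in>set w. x \<le> e" using Cons.prems by auto
  have IH: "sorted (bumped (row_put r x) w)"
    "\<And>m. \<forall>x\<in>set w. m \<le> x \<Longrightarrow> set (bumped (row_put r x) w) \<subseteq> {e\<in>set (row_put r x). m < e}"
    using Cons.IH[OF sorted_row_put[OF Cons.prems(1)] w(1), of x] by blast+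
  \<comment> \<open>The letters after \<open>x\<close> are at least \<open>x\<close>, so what they
    bump exceeds \<open>x\<close> and occurs in the original row \<open>r\<close>.\<close>
  have sub: "set (bumped (row_put r x) w) \<subseteq> {e\<in>set r. x < e}"
    using IH(2)[OF w(2)] set_row_put[of r x] by auto
  have "sorted (row_out r x @ bumped (row_put r x) w)"
  proof (rule row_cases[of r x])
    assume "\<forall>e\<in>set r. e \<le> x"
    then show ?thesis using IH(1) row_append[of r x] by simp
  next
    fix p y q assume y: "r = p @ y # q" "\<forall>e\<in>set p. e \<le> x" "x < y"
    then have "\<forall>e\<in>{e\<in>set r. x < e}. y \<le> e" using Cons.prems(1) by (auto simp: sorted_append)
    then show ?thesis using IH(1) sub y row_bump[OF y(2,3), of q] by auto
  qed
  then show ?case using sub set_row_out[of r x] by fastforce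
qed simp

text \<open>A sorted word bumps a sorted word out of each row and nothing out of an empty row, so at
  most one row is created on top.\<close>

lemma length_insert_sorted:
  assumes "rows_ok T" "sorted w"
  shows "length (insert_word T w) \<le> Suc (length T)"
  using assms
proof (induction T arbitrary: w rule: rev_induct)
  case Nil
  have "set (bumped [] w) \<subseteq> {e\<in>set []. 0 < e}"
    using sorted_bumped[of "[]" w] Nil(2) by auto
  then have "bumped [] w = []" by simp
  then show ?case using insert_word_empty[of w] by (cases "w = []") auto
next
  case (snoc r T)
  have r: "r \<noteq> []" "sorted r" and T: "rows_ok T" using snoc.prems by simp_all
  have "sorted (bumped r w)" using sorted_bumped[OF r(2) snoc.prems(2)] by blast
  then show ?case using snoc.IH[OF T] by (simp add: insert_word_snoc[OF r])
qed

text \<open>Each row of \<open>T\<close> adds at most one row. The bound later ensures that the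
  paddings given by \<open>sigma_R_eq\<close> involve no truncation.\<close>

lemma nrows_tableau_prod:
  assumes "rows_ok S" "rows_ok T"
  shows "nrows (S \<star> T) \<le> nrows S + nrows T"
proof -
  have "length (insert_word S (concat T)) \<le> length S + length T"
    using assms
  proof (induction T arbitrary: S)
    case (Cons r T)
    have "rows_ok T" "sorted r" using Cons.prems by simp_all
    then show ?case
      using length_insert_sorted[OF Cons.prems(1), of r]
        Cons.IH[OF rows_ok_insert_word[OF Cons.prems(1)], of r]
      by (simp add: insert_word_append)
  qed simp
  then show ?thesis by (simp add: tableau_prod_def row_reading_def nrows_def)
qed

text \<open>Inserting \<open>x\<close> increases the number of letters \<open>\<le> z\<close> unless \<open>z < x\<close> or the bumped letter is
  \<open>\<le> z\<close> too. This makes it possible to compare two rows that receive the same word.\<close>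

lemma count_row_put:
  assumes "sorted r"
  shows "length (filter (\<lambda>e. e \<le> z) (row_put r x)) = length (filter (\<lambda>e. e \<le> z) r) +
    (if x \<le> z \<and> length (filter (\<lambda>e. e \<le> z) r) = length (filter (\<lambda>e. e \<le> x) r) then 1 else 0)"
proof (rule row_cases[of r x])
  assume x: "\<forall>e\<in>set r. e \<le> x"
  then have "filter (\<lambda>e. e \<le> x) r = r" by (simp add: filter_id_conv)
  moreover have "filter (\<lambda>e. e \<le> z) r = r" if "x \<le> z" using x that by (auto simp: filter_id_conv)
  ultimately show ?thesis using row_append[OF x] by simp
next
  fix p y q assume y: "r = p @ y # q" "\<forall>e\<in>set p. e \<le> x" "x < y"
  have q: "\<forall>e\<in>set q. y \<le> e" using assms y(1) by (auto simp: sorted_append)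
  have "filter (\<lambda>e. e \<le> x) q = []" using q y(3) by (auto simp: filter_empty_conv)
  moreover have "filter (\<lambda>e. e \<le> x) p = p" using y(2) by (simp add: filter_id_conv)
  moreover have "filter (\<lambda>e. e \<le> z) p = p" if "x \<le> z" using y(2) that by (auto simp: filter_id_conv)
  moreover have "filter (\<lambda>e. e \<le> z) q = []" if "z < y" using q that by (auto simp: filter_empty_conv)
  ultimately show ?thesis using y(3) unfolding y(1) row_bump[OF y(2,3)] by auto
qed

text \<open>If only the count for \<open>r\<close> grows, then \<open>r\<close> has as many letters
  \<open>\<le> z\<close> as \<open>\<le> x\<close>, while \<open>b\<close> has strictly more letters
  \<open>\<le> z\<close> than \<open>\<le> x\<close>. The bound at \<open>x\<close> then leaves room
  for one more letter.\<close>

lemma count_foldl_row_put: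
  assumes "sorted r" "sorted b"
    "\<And>z. length (filter (\<lambda>e. e \<le> z) r) \<le> a + length (filter (\<lambda>e. e \<le> z) b)"
  shows "length (filter (\<lambda>e. e \<le> z) (foldl row_put r w)) \<le>
    a + length (filter (\<lambda>e. e \<le> z) (foldl row_put b w))"
  using assms
proof (induction w arbitrary: r b)
  case (Cons x w)
  have "length (filter (\<lambda>e. e \<le> z) (row_put r x)) \<le> a + length (filter (\<lambda>e. e \<le> z) (row_put b x))" for z
  proof -
    have "length (filter (\<lambda>e. e \<le> x) b) \<le> length (filter (\<lambda>e. e \<le> z) b)" if "x \<le> z"
      using that by (induction b) auto
    then show ?thesis
      using Cons.prems(3)[of z] Cons.prems(3)[of x]
      unfolding count_row_put[OF Cons.prems(1)] count_row_put[OF Cons.prems(2)]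
      by (simp split: if_splits) linarith
  qed
  then show ?case
    using Cons.IH[OF sorted_row_put[OF Cons.prems(1)] sorted_row_put[OF Cons.prems(2)]] by simp
qed simp

lemma length_foldl_row_put:
  assumes "sorted r"
  shows "length (foldl row_put r w) \<le> length r + length (foldl row_put [] w)"
proof -
  \<comment> \<open>Any bound for all letters would do; it turns the counts into lengths.\<close>
  define z where "z = sum_list (foldl row_put r w) + sum_list (foldl row_put [] w)"
  have *: "filter (\<lambda>e. e \<le> z) v = v" if "sum_list v \<le> z" for v :: "nat list"
    using that member_le_sum_list[of _ v] by (auto simp: filter_id_conv intro: order_trans)
  have "filter (\<lambda>e. e \<le> z) (foldl row_put r w) = foldl row_put r w"
    "filter (\<lambda>e. e \<le> z) (foldl row_put [] w) = foldl row_put [] w"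
    by (rule *, simp add: z_def)+
  then show ?thesis
    using count_foldl_row_put[of r "[]" "length r" z w] assms by (simp add: le_trans[OF length_filter_le])
qed

lemma ncols_insert_word:
  assumes "rows_ok T"
  shows "ncols (insert_word T w) = length (foldl row_put (if T = [] then [] else last T) w)"
proof (cases T rule: rev_cases)
  case Nil
  then show ?thesis using insert_word_empty[of w] by (cases "w = []") (auto simp: ncols_def)
next
  case (snoc T' r)
  then have "r \<noteq> []" "sorted r" using assms by simp_all
  then show ?thesis using snoc by (simp add: insert_word_snoc ncols_def)
qed

text \<open>The bottom row of the product arises from that of \<open>S\<close> by inserting the
  reading of \<open>T\<close>. Inserted into the empty row, the same word gives length
  \<open>ncols T\<close>, because \<open>T\<close> is the tableau of its own reading.\<close>

lemma ncols_tableau_prod: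
  assumes "S \<in> YT n" "T \<in> YT n"
  shows "ncols (S \<star> T) \<le> ncols S + ncols T"
proof -
  have "ncols T = ncols (insert_word [] (concat T))"
    using tableau_of_reading[OF assms(2)] by (simp add: tableau_of_def)
  also have "\<dots> = length (foldl row_put [] (concat T))"
    by (simp add: ncols_insert_word)
  finally have T: "ncols T = length (foldl row_put [] (concat T))" .
  have "sorted (if S = [] then [] else last S)"
    using YT_rows_ok[OF assms(1)] by (auto simp: rows_ok_def)
  from length_foldl_row_put[OF this, of "concat T"] show ?thesis
    unfolding tableau_prod_def row_reading_def ncols_insert_word[OF YT_rows_ok[OF assms(1)]] T
    by (cases "S = []") (simp_all add: ncols_def)
qed

section \<open>The two braidings\<close>

lemma raise_tableau_of:
  "tableau_of (raised i c w) = raise_tableau i c (tableau_of w)"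
  "carry i c (concat (tableau_of w)) = carry i c w"
  using raise_insert_word[of "[]" i c w] by (simp_all add: tableau_of_def)

lemma raised_letters: "set w \<subseteq> {1..n} \<Longrightarrow> i \<in> {1..<n} \<Longrightarrow> set (raised i c w) \<subseteq> {1..n}"
  by (induction w arbitrary: c) auto

lemma raised_letters_inv: "set (raised i c w) \<subseteq> {1..n} \<Longrightarrow> i \<in> {1..<n} \<Longrightarrow> set w \<subseteq> {1..n}"
  by (induction w arbitrary: c) (auto split: if_splits)

lemma tableau_of_YT: "set w \<subseteq> {1..n} \<Longrightarrow> tableau_of w \<in> YT n"
  by (simp add: tableau_of_def insert_word_YT)

lemma raise_tableau_YT:
  assumes "T \<in> YT n" "i \<in> {1..<n}"
  shows "raise_tableau i c T \<in> YT n"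
proof -
  have "raise_tableau i c T = tableau_of (raised i c (concat T))"
    by (simp add: raise_tableau_of tableau_of_reading[OF assms(1)])
  then show ?thesis
    using tableau_of_YT raised_letters[OF YT_letters[OF assms(1)] assms(2)] by simp
qed

text \<open>Insertion commutes with raising and \<open>T\<close> is recovered from its reading, so \<open>v\<close> and the reading
  of its tableau have the same raised word and the same final counter value. Hence they are equal.\<close>

lemma raised_eq_reading:
  assumes "raised i c v = concat T" "T \<in> YT n" "i \<in> {1..<n}"
  shows "tableau_of v \<in> YT n" "concat (tableau_of v) = v" "raise_tableau i c (tableau_of v) = T"
proof -
  show T: "raise_tableau i c (tableau_of v) = T"
    using raise_tableau_of(1)[of i c v] tableau_of_reading[OF assms(2)] assms(1) by simp
  have "raised i c (concat (tableau_of v)) = raised i c v"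
    using T assms(1) by (metis concat_raise_tableau)
  then show "concat (tableau_of v) = v"
    using raised_inject raise_tableau_of(2) by blast
  show "tableau_of v \<in> YT n"
    using raised_letters_inv[of i c v n] YT_letters[OF assms(2)] assms(1,3) tableau_of_YT by simp
qed

lemma raise_tableau_prod:
  assumes "rows_ok S"
  shows "raise_tableau i c S \<star> raise_tableau i (carry i c (concat S)) T = raise_tableau i c (S \<star> T)"
    and "carry i c (concat (S \<star> T)) = carry i c (concat S @ concat T)"
  using raise_insert_word[OF assms, of i c "concat T"]
  by (simp_all add: tableau_prod_def row_reading_def)

section \<open>Cutting between rows\<close>

lemma take_raised: "take m (raised i c w) = raised i c (take m w)"
  and drop_raised: "drop m (raised i c w) = raised i (carry i c (take m w)) (drop m w)"
proof -
  have "raised i c w = raised i c (take m w) @ raised i (carry i c (take m w)) (drop m w)"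
    by (metis append_take_drop_id raised_append)
  then show "take m (raised i c w) = raised i c (take m w)"
    "drop m (raised i c w) = raised i (carry i c (take m w)) (drop m w)"
    by (auto simp: min_def)
qed

lemma take_raise_tableau: "take m (raise_tableau i c T) = raise_tableau i c (take m T)"
  and drop_raise_tableau: "drop m (raise_tableau i c T) =
    raise_tableau i (carry i c (concat (take m T))) (drop m T)"
proof -
  have "raise_tableau i c T =
      raise_tableau i c (take m T) @ raise_tableau i (carry i c (concat (take m T))) (drop m T)"
    by (metis append_take_drop_id raise_tableau_append)
  then show "take m (raise_tableau i c T) = raise_tableau i c (take m T)"
    "drop m (raise_tableau i c T) = raise_tableau i (carry i c (concat (take m T))) (drop m T)"
    by (auto simp: min_def)
qed

lemma take_YT: "T \<in> YT n \<Longrightarrow> take m T \<in> YT n"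
  by (metis YT_append_iff append_take_drop_id)

lemma drop_YT: "T \<in> YT n \<Longrightarrow> drop m T \<in> YT n"
  by (metis YT_append_iff append_take_drop_id)

lemma tableau_prod_YT: "S \<in> YT n \<Longrightarrow> T \<in> YT n \<Longrightarrow> S \<star> T \<in> YT n"
  unfolding tableau_prod_def row_reading_def by (intro insert_word_YT YT_letters)

text \<open>The cut is forced: if \<open>a1'\<close> is \<open>0\<close>, then \<open>T1'\<close>
  has \<open>a1 + nrows T1\<close> rows, and otherwise \<open>T2'\<close> is empty. The truncated
  difference \<open>m\<close> covers both cases.\<close>

lemma sigma_R_eq:
  assumes "T1 \<in> YT n" "T2 \<in> YT n"
  shows "sigma_R n ((T1, a1), (T2, a2)) = (let S = T1 \<star> T2; m = nrows S - (a1 + nrows T1) in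
    ((take m S, a2 + nrows T2 - m), (drop m S, a1 + nrows T1 - (nrows S - m))))"
proof -
  define S where "S = T1 \<star> T2"
  define m where "m = nrows S - (a1 + nrows T1)"
  have S: "S \<in> YT n" unfolding S_def using assms by (rule tableau_prod_YT)
  have le: "nrows S \<le> nrows T1 + nrows T2"
    unfolding S_def using assms by (intro nrows_tableau_prod YT_rows_ok)
  show ?thesis
    unfolding sigma_R_def Let_def prod.case S_def[symmetric] m_def[symmetric]
  proof (rule the_equality)
    show "\<exists>T1' a1' T2' a2'. ((take m S, a2 + nrows T2 - m), (drop m S, a1 + nrows T1 - (nrows S - m))) =
        ((T2', a2'), (T1', a1')) \<and> T1' \<in> YT n \<and> T2' \<in> YT n \<and> T2' @ T1' = S \<and>
        a1' + nrows T1' = a1 + nrows T1 \<and> a2' + nrows T2' = a2 + nrows T2 \<and>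
        (a1' > 0 \<longleftrightarrow> nrows S < a1 + nrows T1) \<and> (a1' > 0 \<longrightarrow> T2' = [])"
    proof (intro exI conjI, rule refl)
    qed (use le take_YT[OF S] drop_YT[OF S] in \<open>auto simp: nrows_def m_def\<close>)
  next
    fix P
    assume "\<exists>T1' a1' T2' a2'. P = ((T2', a2'), (T1', a1')) \<and> T1' \<in> YT n \<and> T2' \<in> YT n \<and>
        T2' @ T1' = S \<and>
        a1' + nrows T1' = a1 + nrows T1 \<and> a2' + nrows T2' = a2 + nrows T2 \<and>
        (a1' > 0 \<longleftrightarrow> nrows S < a1 + nrows T1) \<and> (a1' > 0 \<longrightarrow> T2' = [])"
    then obtain T1' a1' T2' a2' where P: "P = ((T2', a2'), (T1', a1'))" and ST: "S = T2' @ T1'"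
      and a: "a1' + nrows T1' = a1 + nrows T1" "a2' + nrows T2' = a2 + nrows T2"
      and pos: "a1' > 0 \<longleftrightarrow> nrows S < a1 + nrows T1" "a1' > 0 \<longrightarrow> T2' = []" by blast
    have m: "m = nrows T2'"
      using a pos unfolding m_def ST by (cases "a1' > 0") (auto simp: nrows_def)
    then have "take m S = T2'" "drop m S = T1'" by (simp_all add: ST nrows_def)
    then show "P = ((take m S, a2 + nrows T2 - m), (drop m S, a1 + nrows T1 - (nrows S - m)))"
    proof -
      have "a2' = a2 + nrows T2 - m" "a1' = a1 + nrows T1 - (nrows S - m)"
        using a m by (simp_all add: ST nrows_def)
      then show ?thesis using P \<open>take m S = T2'\<close> \<open>drop m S = T1'\<close> by simp
    qed
  qed
qed

section \<open>Cutting between columns\<close>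

definition left_part :: "nat \<Rightarrow> tableau \<Rightarrow> tableau" where
  "left_part m T = filter (\<lambda>r. r \<noteq> []) (map (take m) T)"

definition right_part :: "nat \<Rightarrow> tableau \<Rightarrow> tableau" where
  "right_part m T = filter (\<lambda>r. r \<noteq> []) (map (drop m) T)"

lemma concat_filter_not_Nil [simp]: "concat (filter (\<lambda>r. r \<noteq> []) T) = concat T"
  by (induction T) auto

lemma raise_tableau_filter:
  "raise_tableau i c (filter (\<lambda>r. r \<noteq> []) T) = filter (\<lambda>r. r \<noteq> []) (raise_tableau i c T)"
proof (induction T arbitrary: c)
  case (Cons r T)
  have "raised i c r = [] \<longleftrightarrow> r = []" by (metis length_0_conv length_raised)
  then show ?case using Cons by auto
qed simp

lemma YT_dominates:
  assumes "S @ [r] \<in> YT n" "s \<in> set S"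
  shows "dominates_row s r"
  using assms
proof (induction S arbitrary: r rule: rev_induct)
  case (snoc l S)
  have *: "S @ [l] \<in> YT n" "dominates_row l r"
    using snoc.prems(1) unfolding YT_append_iff[of "S @ [l]"] by simp_all
  show ?case
  proof (cases "s = l")
    case False
    then have "dominates_row s l" using snoc.IH[OF *(1)] snoc.prems(2) by simp
    with *(2) show ?thesis unfolding dominates_row_def
      by (metis le_trans less_le_trans less_trans)
  qed (simp add: *)
qed simp

text \<open>In a sorted word no \<open>i\<close> follows an \<open>i + 1\<close>, so every
  \<open>i + 1\<close> is still pending at the end.\<close>

lemma carry_ge_count: "sorted w \<Longrightarrow> count_list w (Suc i) \<le> carry i c w"
proof (induction w arbitrary: c)
  case (Cons x w)
  have w: "sorted w" using Cons.prems by simp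
  show ?case
  proof (cases "x = Suc i")
    case True
    then have "i \<notin> set w" using Cons.prems by auto
    then have "carry i k w = k + count_list w (Suc i)" for k
      by (induction w arbitrary: k) auto
    then show ?thesis using True by simp
  next
    case False
    then show ?thesis using Cons.IH[OF w] by simp
  qed
qed simp

lemma carry_no_lower: "i \<notin> set w \<Longrightarrow> carry i c w = c + count_list w (Suc i)"
  by (induction w arbitrary: c) auto

lemma raised_below_carry:
  "Suc i \<notin> set w \<Longrightarrow> count_list w i \<le> c \<Longrightarrow> raised i c w = w \<and> carry i c w = c - count_list w i"
  by (induction w arbitrary: c) auto

lemma raise_tableau_no_lower: "i \<notin> set (concat T) \<Longrightarrow> raise_tableau i c T = T"
  by (induction T arbitrary: c) (auto simp: raised_no_lower)

text \<open>By \<open>less\<close>, the counter sees letters of both words only if \<open>h\<close>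
  contains \<open>i\<close> and \<open>D\<close> contains \<open>i + 1\<close>. In that case
  \<open>big\<close> keeps the counter high enough that no letter of \<open>h\<close> is raised in
  either order, and \<open>D\<close> contains no \<open>i\<close>.\<close>

lemma carry_commute:
  assumes less: "\<forall>x\<in>set h. \<forall>d\<in>set (concat D). x < d"
    and big: "i \<in> set h \<and> Suc i \<in> set (concat D) \<longrightarrow> count_list h i \<le> c"
  shows "raised i (carry i c (concat D)) h = raised i c h"
    and "raise_tableau i (carry i c h) D = raise_tableau i c D"
    and "carry i (carry i c h) (concat D) = carry i (carry i c (concat D)) h"
proof -
  consider "i \<notin> set h" "Suc i \<notin> set h" | "i \<notin> set (concat D)" "Suc i \<notin> set (concat D)"
    | "i \<in> set h" "Suc i \<notin> set h" "i \<notin> set (concat D)" "Suc i \<in> set (concat D)"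
    using less by (metis Suc_lessD less_irrefl)
  then have "raised i (carry i c (concat D)) h = raised i c h \<and>
    raise_tableau i (carry i c h) D = raise_tableau i c D \<and>
    carry i (carry i c h) (concat D) = carry i (carry i c (concat D)) h"
  proof cases
    case 1
    then show ?thesis by (simp add: carry_neutral raised_no_lower)
  next
    case 2
    then show ?thesis by (simp add: carry_neutral raise_tableau_no_lower del: set_concat)
  next
    case 3
    have c: "count_list h i \<le> c" using big 3 by blast
    show ?thesis
      using raised_below_carry[OF 3(2) c]
        raised_below_carry[OF 3(2), of "c + count_list (concat D) (Suc i)"] c
      by (simp add: carry_no_lower[OF 3(3)] raise_tableau_no_lower[OF 3(3)] del: set_concat)
  qed
  then show "raised i (carry i c (concat D)) h = raised i c h"
    "raise_tableau i (carry i c h) D = raise_tableau i c D"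
    "carry i (carry i c h) (concat D) = carry i (carry i c (concat D)) h" by auto
qed

text \<open>For the count, let \<open>l\<close> be the row directly above \<open>r\<close>. A letter
  \<open>i + 1\<close> beyond the cut in some row of \<open>S\<close> bounds the entries of
  \<open>l\<close> before the cut by \<open>i + 1\<close>. Hence \<open>l\<close> has
  \<open>i + 1\<close> above each \<open>i\<close> of \<open>take m r\<close>, and these letters are
  pending after the left parts of \<open>S\<close>.\<close>

lemma split_columns_step:
  assumes S: "S @ [r] \<in> YT n"
  shows "\<forall>x\<in>set (take m r). \<forall>d\<in>set (concat (map (drop m) S)). x < d"
    and "i \<in> set (take m r) \<and> Suc i \<in> set (concat (map (drop m) S)) \<longrightarrow>
      count_list (take m r) i \<le> carry i c (concat (map (take m) S))"
proof -
  have r: "sorted r" using S by (simp add: YT_append_iff YT_single_iff)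
  have ent: "\<exists>s\<in>set S. \<exists>k. m \<le> k \<and> k < length s \<and> d = s ! k"
    if d: "d \<in> set (concat (map (drop m) S))" for d
  proof -
    obtain s where s: "s \<in> set S" "d \<in> set (drop m s)" using d by auto
    then obtain j where "j < length (drop m s)" "d = drop m s ! j" by (metis in_set_conv_nth)
    then have "m \<le> m + j \<and> m + j < length s \<and> d = s ! (m + j)" by auto
    then show ?thesis using s(1) by blast
  qed
  have pre: "\<exists>j. j < m \<and> j < length r \<and> x = r ! j" if "x \<in> set (take m r)" for x
    using that by (auto simp: in_set_conv_nth)
  show "\<forall>x\<in>set (take m r). \<forall>d\<in>set (concat (map (drop m) S)). x < d"
  proof (intro ballI)
    fix x d assume "x \<in> set (take m r)" "d \<in> set (concat (map (drop m) S))"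
    from pre[OF this(1)] ent[OF this(2)] obtain j s k where
      j: "j < m" "x = r ! j" and s: "s \<in> set S" "m \<le> k" "k < length s" "d = s ! k" by blast
    have "r ! k < s ! k" "length s \<le> length r"
      using YT_dominates[OF S s(1)] s by (auto simp: dominates_row_def)
    moreover have "r ! j \<le> r ! k"
      using r j s calculation by (intro sorted_nth_mono) auto
    ultimately show "x < d" using j s by simp
  qed
  have "count_list (take m r) i \<le> carry i c (concat (map (take m) S))"
    if i: "i \<in> set (take m r)" and Si: "Suc i \<in> set (concat (map (drop m) S))"
  proof -
  obtain s k where s: "s \<in> set S" "m \<le> k" "k < length s" "Suc i = s ! k"
    using ent[OF Si] by blast
  obtain S' l where S': "S = S' @ [l]" using s(1) by (cases S rule: rev_cases) auto
  have l: "sorted l" "length l \<le> length r" "\<And>j. j < length l \<Longrightarrow> r ! j < l ! j"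
    using S YT_dominates[OF S, of l] S' by (auto simp: YT_def dominates_row_def)
  have "S' @ [l] \<in> YT n" using S S' unfolding YT_append_iff[of S] by simp
  then have kl: "k < length l" "l ! k \<le> Suc i"
    using YT_dominates[of S' l n s] s S' by (auto simp: dominates_row_def less_imp_le)
  have "r ! j = i \<Longrightarrow> l ! j = Suc i" if "j < m" for j
    using l(3)[of j] sorted_nth_mono[OF l(1), of j k] kl that s(2) by force
  then have nth: "\<forall>j<m. take m r ! j = i \<longrightarrow> take m l ! j = Suc i" by simp
  have "length (take m r) = length (take m l)" "length (take m r) = m" using kl l(2) s(2) by auto
  moreover have "count_list u i \<le> count_list v (Suc i)"
    if "length u = length v" "\<forall>j<length u. u ! j = i \<longrightarrow> v ! j = Suc i" for u v :: "nat list"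
    using that
  proof (induction u v rule: list_induct2)
    case (Cons x u y v)
    have "\<forall>j<length u. u ! j = i \<longrightarrow> v ! j = Suc i" using Cons.prems by auto
    moreover have "x = i \<longrightarrow> y = Suc i" using Cons.prems by auto
    ultimately show ?case using Cons.IH by auto
  qed simp
  ultimately have "count_list (take m r) i \<le> count_list (take m l) (Suc i)"
    using nth by simp
  also have "\<dots> \<le> carry i c (concat (map (take m) S))"
    unfolding S' using carry_ge_count[OF sorted_wrt_take[OF l(1)]] by simp
  finally show ?thesis .
  qed
  then show "i \<in> set (take m r) \<and> Suc i \<in> set (concat (map (drop m) S)) \<longrightarrow>
      count_list (take m r) i \<le> carry i c (concat (map (take m) S))" by blast
qed

text \<open>Adding a bottom row \<open>r\<close> requires exchanging \<open>take m r\<close> with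
  the right parts of the rows above it, which \<open>carry_commute\<close> permits.\<close>

lemma raise_split_columns:
  assumes "S \<in> YT n"
  shows "raise_tableau i c (map (take m) S) = map (take m) (raise_tableau i c S) \<and>
    raise_tableau i (carry i c (concat (map (take m) S))) (map (drop m) S) =
      map (drop m) (raise_tableau i c S) \<and>
    carry i (carry i c (concat (map (take m) S))) (concat (map (drop m) S)) = carry i c (concat S)"
  using assms
proof (induction S rule: rev_induct)
  case (snoc r S)
  let ?c = "carry i c (concat (map (take m) S))" and ?D = "map (drop m) S" and ?h = "take m r"
  have "S \<in> YT n" using snoc.prems by (simp add: YT_append_iff)
  note IH = snoc.IH[OF this]
  note comm = carry_commute[OF split_columns_step(1)[OF snoc.prems, of m]
      split_columns_step(2)[OF snoc.prems, of i m c]]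
  have c: "carry i ?c (concat ?D) = carry i c (concat S)" using IH by blast
  have h: "raised i ?c ?h = take m (raised i (carry i c (concat S)) r)"
    using comm(1) c by (simp add: take_raised)
  have cc: "carry i (carry i ?c ?h) (concat ?D) = carry i (carry i c (concat S)) ?h"
    using comm(3) c by simp
  have D: "raise_tableau i (carry i ?c ?h) ?D = map (drop m) (raise_tableau i c S)"
    using comm(2) IH by simp
  have t: "carry i c' r = carry i (carry i c' ?h) (drop m r)" for c'
    by (metis append_take_drop_id carry_append)
  show ?case
    using IH h D cc t by (simp add: drop_raised)
qed simp

lemma YT_snocI:
  assumes "S \<in> YT n" "sorted r" "set r \<subseteq> {1..n}" "S \<noteq> [] \<Longrightarrow> dominates_row (last S) r"
  shows "S @ (if r = [] then [] else [r]) \<in> YT n"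
  using assms by (auto simp: YT_append_iff YT_single_iff)

lemma part_YT:
  assumes "S \<in> YT n"
  shows "left_part m S \<in> YT n" "right_part m S \<in> YT n"
proof -
  have dom: "dominates_row (take m r) (take m s)" "dominates_row (drop m r) (drop m s)"
    if "dominates_row r s" for r s
    using that by (auto simp: dominates_row_def)
  have "left_part m S \<in> YT n \<and> right_part m S \<in> YT n"
    using assms
  proof (induction S rule: rev_induct)
    case (snoc r S)
    have S: "S \<in> YT n" and r: "sorted r" "set r \<subseteq> {1..n}"
      using snoc.prems by (auto simp: YT_append_iff YT_single_iff)
    have ts: "set (take m r) \<subseteq> {1..n}" "set (drop m r) \<subseteq> {1..n}"
      using r set_take_subset[of m r] set_drop_subset[of m r] by auto
    have L: "dominates_row (last (left_part m S)) (take m r)" if "left_part m S \<noteq> []"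
    proof -
      have "last (left_part m S) \<in> set (left_part m S)" using that by (rule last_in_set)
      then show ?thesis using dom YT_dominates[OF snoc.prems] by (auto simp: left_part_def)
    qed
    have R: "dominates_row (last (right_part m S)) (drop m r)" if "right_part m S \<noteq> []"
    proof -
      have "last (right_part m S) \<in> set (right_part m S)" using that by (rule last_in_set)
      then show ?thesis using dom YT_dominates[OF snoc.prems] by (auto simp: right_part_def)
    qed
    have "left_part m (S @ [r]) = left_part m S @ (if take m r = [] then [] else [take m r])"
      "right_part m (S @ [r]) = right_part m S @ (if drop m r = [] then [] else [drop m r])"
      by (auto simp: left_part_def right_part_def)
    moreover have "left_part m S @ (if take m r = [] then [] else [take m r]) \<in> YT n"
      using snoc.IH[OF S] L ts sorted_wrt_take[OF r(1)] by (intro YT_snocI) auto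
    moreover have "right_part m S @ (if drop m r = [] then [] else [drop m r]) \<in> YT n"
      using snoc.IH[OF S] R ts sorted_wrt_drop[OF r(1)] by (intro YT_snocI) auto
    ultimately show ?case by simp
  qed (simp add: left_part_def right_part_def)
  then show "left_part m S \<in> YT n" "right_part m S \<in> YT n" by auto
qed

lemma raise_parts:
  assumes "S \<in> YT n"
  shows "left_part m (raise_tableau i c S) = raise_tableau i c (left_part m S)"
    and "right_part m (raise_tableau i c S) =
      raise_tableau i (carry i c (concat (left_part m S))) (right_part m S)"
    and "carry i c (concat (left_part m S) @ concat (right_part m S)) = carry i c (concat S)"
  using raise_split_columns[OF assms, of i c m]
  by (simp_all add: left_part_def right_part_def raise_tableau_filter)

section \<open>Columns of the two parts, and recovery of a tableau from its columns\<close>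

lemma length_columns [simp]: "length (columns T) = ncols T"
  by (simp add: columns_def)

lemma YT_length_le:
  assumes "T \<in> YT n" "r \<in> set T"
  shows "length r \<le> ncols T"
proof (cases T rule: rev_cases)
  case (snoc S l)
  then show ?thesis using assms YT_dominates[of S l n r] by (auto simp: ncols_def dominates_row_def)
qed (use assms in simp)

lemma ncols_parts:
  assumes "S \<in> YT n" "m \<le> ncols S"
  shows "ncols (left_part m S) = m" "ncols (right_part m S) = ncols S - m"
proof -
  have "ncols (left_part m S) = m \<and> ncols (right_part m S) = ncols S - m"
  proof (cases S rule: rev_cases)
    case Nil
    then show ?thesis using assms(2) by (simp add: ncols_def left_part_def right_part_def)
  next
    case (snoc T r)
    have r: "r \<noteq> []" "m \<le> length r" using assms snoc by (auto simp: YT_append_iff YT_single_iff ncols_def)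
    have "left_part m S = []" if "m = 0" using that by (simp add: left_part_def)
    moreover have "right_part m S = []" if "m = length r"
    proof -
      have "length s \<le> m" if "s \<in> set S" for s
        using YT_length_le[OF assms(1) that] \<open>m = length r\<close> snoc by (simp add: ncols_def)
      then show ?thesis by (simp add: right_part_def filter_empty_conv)
    qed
    moreover have "ncols (left_part m S) = m" if "m > 0"
      using that r snoc by (simp add: left_part_def ncols_def)
    moreover have "ncols (right_part m S) = ncols S - m" if "m < length r"
      using that r snoc by (simp add: right_part_def ncols_def)
    ultimately show ?thesis using r(2) snoc by (cases "m = 0"; cases "m = length r") (auto simp: ncols_def)
  qed
  then show "ncols (left_part m S) = m" "ncols (right_part m S) = ncols S - m" by auto
qed

lemma columns_parts:
  assumes "S \<in> YT n" "m \<le> ncols S"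
  shows "columns (left_part m S) @ columns (right_part m S) = columns S"
proof (rule nth_equalityI)
  show len: "length (columns (left_part m S) @ columns (right_part m S)) = length (columns S)"
    using ncols_parts[OF assms] assms(2) by simp
  fix k assume "k < length (columns (left_part m S) @ columns (right_part m S))"
  then have k: "k < ncols S" using len by simp
  show "(columns (left_part m S) @ columns (right_part m S)) ! k = columns S ! k"
  proof (cases "k < m")
    case True
    have "map (\<lambda>r. r ! k) (filter (\<lambda>r. k < length r) (filter (\<lambda>r. r \<noteq> []) (map (take m) S))) =
      map (\<lambda>r. r ! k) (filter (\<lambda>r. k < length r) S)"
      using True by (induction S) auto
    then show ?thesis using True k ncols_parts[OF assms]
      by (simp add: nth_append columns_def left_part_def)
  next
    case False
    have "map (\<lambda>r. r ! (k - m)) (filter (\<lambda>r. k - m < length r) (filter (\<lambda>r. r \<noteq> []) (map (drop m) S))) =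
      map (\<lambda>r. r ! k) (filter (\<lambda>r. k < length r) S)"
      using False by (induction S) auto
    moreover have "k - m < ncols S - m" using False k by simp
    ultimately show ?thesis using False k ncols_parts[OF assms]
      by (simp add: nth_append columns_def right_part_def)
  qed
qed

text \<open>List transposition fits rows given longest first, so rows and columns are reversed. This
  gives access to the inversion theorem for \<open>List.transpose\<close>.\<close>

lemma columns_transpose:
  assumes "T \<in> YT n"
  shows "columns T = map rev (List.transpose (rev T))"
proof (rule nth_equalityI)
  have "foldr (\<lambda>xs. max (length xs)) (rev T) 0 = ncols T"
    using assms
  proof (induction T rule: rev_induct)
    case (snoc r T)
    have T: "T \<in> YT n" using snoc.prems by (simp add: YT_append_iff)
    have "ncols T \<le> length r"
      using YT_dominates[OF snoc.prems] by (cases "T = []") (auto simp: ncols_def dominates_row_def)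
    then show ?case using snoc.IH[OF T] by (simp add: ncols_def)
  qed (simp add: ncols_def)
  then show len: "length (columns T) = length (map rev (List.transpose (rev T)))"
    by (simp add: length_transpose)
  fix k assume k: "k < length (columns T)"
  then have "k < length (List.transpose (rev T))" using len by simp
  then show "columns T ! k = map rev (List.transpose (rev T)) ! k"
    using k by (simp add: columns_def nth_transpose rev_map rev_filter)
qed

text \<open>From the bottom up, the rows are non-empty and their lengths do not increase, so
  transposing twice restores them.\<close>

lemma columns_inject:
  assumes "S \<in> YT n" "T \<in> YT n" "columns S = columns T"
  shows "S = T"
proof -
  have inv: "List.transpose (List.transpose (rev T)) = rev T" if T: "T \<in> YT n" for T
  proof -
    have "sorted (map length T)"
      using T
    proof (induction T rule: rev_induct)
      case (snoc r T)
      have "T \<in> YT n" using snoc.prems by (simp add: YT_append_iff)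
      then show ?case using snoc.IH YT_dominates[OF snoc.prems]
        by (auto simp: sorted_append dominates_row_def)
    qed simp
    moreover have "takeWhile (\<lambda>r. r \<noteq> []) (rev T) = rev T"
      using T by (auto simp: YT_def takeWhile_eq_all_conv)
    ultimately show ?thesis
      by (subst transpose_transpose) (simp_all add: rev_map)
  qed
  have "map rev (map rev (List.transpose (rev S))) = map rev (map rev (List.transpose (rev T)))"
    using assms by (simp only: columns_transpose)
  then have "List.transpose (rev S) = List.transpose (rev T)" by simp
  then have "rev S = rev T" using inv[OF assms(1)] inv[OF assms(2)] by metis
  then show ?thesis by simp
qed

text \<open>Again the cut is forced: if \<open>a2'\<close> is \<open>0\<close>, then
  \<open>T2'\<close> has \<open>a2 + ncols T2\<close> columns, and otherwise \<open>T1'\<close> is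
  empty and \<open>T2'\<close> takes all columns. Uniqueness of the tableaux comes from
  \<open>columns_inject\<close>.\<close>

lemma sigma_C_eq:
  assumes "T1 \<in> YT n" "T2 \<in> YT n"
  shows "sigma_C n ((T1, a1), (T2, a2)) = (let S = T1 \<star> T2; m = min (ncols S) (a2 + ncols T2) in
    ((left_part m S, a2 + ncols T2 - m), (right_part m S, a1 + ncols T1 - (ncols S - m))))"
proof -
  define S where "S = T1 \<star> T2"
  define m where "m = min (ncols S) (a2 + ncols T2)"
  have S: "S \<in> YT n" unfolding S_def using assms by (rule tableau_prod_YT)
  have le: "ncols S \<le> ncols T1 + ncols T2"
    unfolding S_def using assms by (rule ncols_tableau_prod)
  have "m \<le> ncols S" by (simp add: m_def)
  note part = ncols_parts[OF S this] columns_parts[OF S this]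
  have Nil: "T = []" if "ncols T = 0" "T \<in> YT n" for T
    using that by (cases T rule: rev_cases) (auto simp: ncols_def YT_append_iff YT_single_iff)
  show ?thesis
    unfolding sigma_C_def Let_def prod.case S_def[symmetric] m_def[symmetric]
  proof (rule the_equality)
    show "\<exists>T1' a1' T2' a2'. ((left_part m S, a2 + ncols T2 - m), (right_part m S, a1 + ncols T1 - (ncols S - m))) =
        ((T2', a2'), (T1', a1')) \<and> T1' \<in> YT n \<and> T2' \<in> YT n \<and>
        columns T2' @ columns T1' = columns S \<and>
        a1' + ncols T1' = a1 + ncols T1 \<and> a2' + ncols T2' = a2 + ncols T2 \<and>
        (a2' > 0 \<longleftrightarrow> ncols S < a2 + ncols T2) \<and> (a2' > 0 \<longrightarrow> T1' = [])"
    proof (intro exI conjI, rule refl)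
    qed (use le part part_YT[OF S] Nil[of "right_part m S"] \<open>m \<le> ncols S\<close> in
        \<open>auto simp: m_def min_def split: if_splits\<close>)
  next
    fix P
    assume "\<exists>T1' a1' T2' a2'. P = ((T2', a2'), (T1', a1')) \<and> T1' \<in> YT n \<and> T2' \<in> YT n \<and>
        columns T2' @ columns T1' = columns S \<and>
        a1' + ncols T1' = a1 + ncols T1 \<and> a2' + ncols T2' = a2 + ncols T2 \<and>
        (a2' > 0 \<longleftrightarrow> ncols S < a2 + ncols T2) \<and> (a2' > 0 \<longrightarrow> T1' = [])"
    then obtain T1' a1' T2' a2' where P: "P = ((T2', a2'), (T1', a1'))"
      and YT: "T1' \<in> YT n" "T2' \<in> YT n" and ST: "columns T2' @ columns T1' = columns S"
      and a: "a1' + ncols T1' = a1 + ncols T1" "a2' + ncols T2' = a2 + ncols T2"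
      and pos: "a2' > 0 \<longleftrightarrow> ncols S < a2 + ncols T2" "a2' > 0 \<longrightarrow> T1' = []" by blast
    have nS: "ncols S = ncols T2' + ncols T1'" using arg_cong[OF ST, of length] by simp
    have m: "m = ncols T2'"
      using a pos nS unfolding m_def by (cases "a2' > 0") (auto simp: ncols_def)
    have "columns T2' = columns (left_part m S)" "columns T1' = columns (right_part m S)"
      using ST part m by (metis append_eq_append_conv length_columns)+
    then have "T2' = left_part m S" "T1' = right_part m S"
      using columns_inject YT part_YT[OF S] by blast+
    then show "P = ((left_part m S, a2 + ncols T2 - m), (right_part m S, a1 + ncols T1 - (ncols S - m)))"
    proof -
      have "a2' = a2 + ncols T2 - m" "a1' = a1 + ncols T1 - (ncols S - m)"
        using a m nS by linarith+
      then show ?thesis using P \<open>T2' = left_part m S\<close> \<open>T1' = right_part m S\<close> by simp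
    qed
  qed
qed

section \<open>Commuting actions\<close>

definition tuple_reading :: "padded list \<Rightarrow> nat list" where
  "tuple_reading t = concat (map (\<lambda>P. concat (fst P)) t)"

primrec raise_tuple :: "nat \<Rightarrow> nat \<Rightarrow> padded list \<Rightarrow> padded list" where
  "raise_tuple i c [] = []"
| "raise_tuple i c (P # t) = (raise_tableau i c (fst P), snd P) #
     raise_tuple i (carry i c (concat (fst P))) t"

lemma tuple_reading_simps [simp]:
  "tuple_reading [] = []" "tuple_reading (P # t) = concat (fst P) @ tuple_reading t"
  "tuple_reading (s @ t) = tuple_reading s @ tuple_reading t"
  by (simp_all add: tuple_reading_def)

lemma raise_tuple_append [simp]:
  "raise_tuple i c (s @ t) = raise_tuple i c s @ raise_tuple i (carry i c (tuple_reading s)) t"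
  by (induction s arbitrary: c) simp_all

lemma tuple_reading_raise_tuple [simp]: "tuple_reading (raise_tuple i c t) = raised i c (tuple_reading t)"
  by (induction t arbitrary: c) simp_all

lemma raise_tuple_map [simp]:
  "map snd (raise_tuple i c t) = map snd t"
  "map (\<lambda>P. length (concat (fst P))) (raise_tuple i c t) = map (\<lambda>P. length (concat (fst P))) t"
  "length (raise_tuple i c t) = length t"
  by (induction t arbitrary: c) simp_all

lemma raise_tuple_tuples: "t \<in> tuples n k \<Longrightarrow> i \<in> {1..<n} \<Longrightarrow> raise_tuple i c t \<in> tuples n k"
proof -
  assume i: "i \<in> {1..<n}"
  have "set t \<subseteq> YT n \<times> UNIV \<Longrightarrow> set (raise_tuple i c t) \<subseteq> YT n \<times> UNIV" for c
    by (induction t arbitrary: c) (auto simp: raise_tableau_YT[OF _ i])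
  then show "t \<in> tuples n k \<Longrightarrow> raise_tuple i c t \<in> tuples n k" by (simp add: tuples_def)
qed

lemma cut_word_concat: "cut_word (map length ws) (concat ws) = ws"
  by (induction ws) simp_all

lemma s_tuple_eqI:
  assumes "u \<in> tuples n k"
    and "s_word i (tuple_reading t) = tuple_reading u"
    and "map (\<lambda>P. length (concat (fst P))) t = map (\<lambda>P. length (concat (fst P))) u"
    and "map snd t = map snd u"
  shows "s_tuple i t = u"
proof -
  let ?ws = "map (\<lambda>P. concat (fst P))"
  have ws: "map (\<lambda>(T, a). row_reading T) v = ?ws v" for v :: "padded list"
    by (auto simp: row_reading_def)
  have len: "map length (?ws t) = map length (?ws u)"
    using assms(3) by (simp add: comp_def)
  have "map tableau_of (?ws u) = map fst u"
    using assms(1) by (auto simp: tuples_def tableau_of_reading)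
  then have "s_tuple i t = zip (map fst u) (map snd u)"
    using assms(2) unfolding s_tuple_def Let_def ws len tuple_reading_def assms(4)
    by (simp add: cut_word_concat del: map_map)
  then show ?thesis by (simp add: zip_map_fst_snd)
qed

lemma s_tuple_raise_tuple:
  assumes "t \<in> tuples n k" "i \<in> {1..<n}" "carry i c (tuple_reading t) = c"
  shows "s_tuple i t = raise_tuple i c t" "s_tuple i (raise_tuple i c t) = t"
  using assms raise_tuple_tuples[OF assms(1,2)]
  by (auto intro!: s_tuple_eqI simp: s_word_raised s_word_of_raised)

text \<open>The word \<open>v\<close> is cut at the length of the first reading;
  \<open>raised_eq_reading\<close> handles that factor, and the rest starts at the counter value
  reached after it.\<close>

lemma raised_eq_tuple_reading:
  assumes "set t \<subseteq> YT n \<times> UNIV" "i \<in> {1..<n}" "raised i c v = tuple_reading t"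
  shows "\<exists>u. set u \<subseteq> YT n \<times> UNIV \<and> raise_tuple i c u = t \<and> tuple_reading u = v"
  using assms(1,3)
proof (induction t arbitrary: c v)
  case Nil
  then have "v = []" by (metis length_0_conv length_raised tuple_reading_simps(1))
  then show ?case by (intro exI[of _ "[]"]) simp
next
  case (Cons P t)
  obtain T a where P: "P = (T, a)" by fastforce
  have T: "T \<in> YT n" and t: "set t \<subseteq> YT n \<times> UNIV" using Cons.prems(1) P by auto
  let ?m = "length (concat T)"
  let ?v = "take ?m v" and ?w = "drop ?m v"
  have "raised i c v = concat T @ tuple_reading t" using Cons.prems(2) P by simp
  then have "raised i c ?v = concat T" "raised i (carry i c ?v) ?w = tuple_reading t"
    using take_raised[of ?m i c v] drop_raised[of ?m i c v] by simp_all
  note v = raised_eq_reading[OF this(1) T assms(2)] and w = Cons.IH[OF t this(2)]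
  from w obtain u where u: "set u \<subseteq> YT n \<times> UNIV" "raise_tuple i (carry i c ?v) u = t"
    "tuple_reading u = ?w" by blast
  show ?case
    using u v P by (intro exI[of _ "(tableau_of ?v, a) # u"]) simp
qed

lemma tuple_cases:
  assumes "t \<in> tuples n k" "i \<in> {1..<n}"
  obtains u c where "u \<in> tuples n k" "carry i c (tuple_reading u) = c"
    "t = u \<or> t = raise_tuple i c u"
proof (rule fixed_carry_cases[of i "tuple_reading t"])
  fix c assume "carry i c (tuple_reading t) = c"
  then show ?thesis using that[of t] assms by blast
next
  fix c v assume v: "carry i c v = c" "tuple_reading t = raised i c v"
  then obtain u where u: "set u \<subseteq> YT n \<times> UNIV" "raise_tuple i c u = t" "tuple_reading u = v"
    using raised_eq_tuple_reading[of t n i c v] assms by (auto simp: tuples_def)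
  then have "u \<in> tuples n k" using assms(1) by (auto simp: tuples_def)
  then show ?thesis using that[of u c] u v by blast
qed

text \<open>The local condition through which both braidings are treated. All \<open>c\<close> are
  needed because the preceding entries of a tuple determine the counter at which the pair is met;
  the new paddings must not depend on the raising.\<close>

definition raising_invariant :: "nat \<Rightarrow> (padded \<times> padded \<Rightarrow> padded \<times> padded) \<Rightarrow> bool" where
  "raising_invariant n \<sigma> \<longleftrightarrow> (\<forall>S a T b. S \<in> YT n \<longrightarrow> T \<in> YT n \<longrightarrow>
     (\<exists>S' a' T' b'. \<sigma> ((S, a), (T, b)) = ((S', a'), (T', b')) \<and> S' \<in> YT n \<and> T' \<in> YT n \<and>
       (\<forall>i\<in>{1..<n}. \<forall>c. carry i c (concat S' @ concat T') = carry i c (concat S @ concat T) \<and>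
         \<sigma> ((raise_tableau i c S, a), (raise_tableau i (carry i c (concat S)) T, b)) =
           ((raise_tableau i c S', a'), (raise_tableau i (carry i c (concat S')) T', b')))))"

text \<open>Raising commutes with the product and keeps the number of rows, so the cut is at the
  same row, and the two pieces are consecutive factors of the reading.\<close>

lemma raising_invariant_sigma_R: "raising_invariant n (sigma_R n)"
  unfolding raising_invariant_def
proof (intro allI impI)
  fix S a T b assume ST: "S \<in> YT n" "T \<in> YT n"
  let ?U = "S \<star> T"
  define m where "m = nrows ?U - (a + nrows S)"
  have "sigma_R n ((raise_tableau i c S, a), (raise_tableau i (carry i c (concat S)) T, b)) =
      ((raise_tableau i c (take m ?U), b + nrows T - m),
       (raise_tableau i (carry i c (concat (take m ?U))) (drop m ?U), a + nrows S - (nrows ?U - m)))"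
    if "i \<in> {1..<n}" for i c
    using ST that
    by (simp add: sigma_R_eq raise_tableau_YT raise_tableau_prod YT_rows_ok Let_def
      take_raise_tableau drop_raise_tableau nrows_def m_def)
  moreover have "carry i c (concat (take m ?U) @ concat (drop m ?U)) = carry i c (concat S @ concat T)" for i c
    unfolding concat_append[symmetric] append_take_drop_id
    using raise_tableau_prod(2)[OF YT_rows_ok[OF ST(1)]] by simp
  ultimately show "\<exists>S' a' T' b'. sigma_R n ((S, a), (T, b)) = ((S', a'), (T', b')) \<and> S' \<in> YT n \<and> T' \<in> YT n \<and>
       (\<forall>i\<in>{1..<n}. \<forall>c. carry i c (concat S' @ concat T') = carry i c (concat S @ concat T) \<and>
         sigma_R n ((raise_tableau i c S, a), (raise_tableau i (carry i c (concat S)) T, b)) =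
           ((raise_tableau i c S', a'), (raise_tableau i (carry i c (concat S')) T', b')))"
    using sigma_R_eq[OF ST] take_YT[OF tableau_prod_YT[OF ST]] drop_YT[OF tableau_prod_YT[OF ST]]
    unfolding Let_def m_def by blast
qed

lemma ncols_raise_tableau [simp]: "ncols (raise_tableau i c T) = ncols T"
  by (cases T rule: rev_cases) (simp_all add: ncols_def)

text \<open>The readings of the two parts need not be factors of the row reading, so
  \<open>raise_parts\<close> replaces the cutting of a word.\<close>

lemma raising_invariant_sigma_C: "raising_invariant n (sigma_C n)"
  unfolding raising_invariant_def
proof (intro allI impI)
  fix S a T b assume ST: "S \<in> YT n" "T \<in> YT n"
  let ?U = "S \<star> T"
  note U = tableau_prod_YT[OF ST]
  define m where "m = min (ncols ?U) (b + ncols T)"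
  have "sigma_C n ((raise_tableau i c S, a), (raise_tableau i (carry i c (concat S)) T, b)) =
      ((raise_tableau i c (left_part m ?U), b + ncols T - m),
       (raise_tableau i (carry i c (concat (left_part m ?U))) (right_part m ?U),
        a + ncols S - (ncols ?U - m)))"
    if "i \<in> {1..<n}" for i c
    using ST that
    by (simp add: sigma_C_eq raise_tableau_YT raise_tableau_prod YT_rows_ok Let_def
      raise_parts[OF U] m_def)
  moreover have "carry i c (concat (left_part m ?U) @ concat (right_part m ?U)) = carry i c (concat S @ concat T)" for i c
    unfolding raise_parts(3)[OF U]
    using raise_tableau_prod(2)[OF YT_rows_ok[OF ST(1)]] by simp
  ultimately show "\<exists>S' a' T' b'. sigma_C n ((S, a), (T, b)) = ((S', a'), (T', b')) \<and> S' \<in> YT n \<and> T' \<in> YT n \<and>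
       (\<forall>i\<in>{1..<n}. \<forall>c. carry i c (concat S' @ concat T') = carry i c (concat S @ concat T) \<and>
         sigma_C n ((raise_tableau i c S, a), (raise_tableau i (carry i c (concat S)) T, b)) =
           ((raise_tableau i c S', a'), (raise_tableau i (carry i c (concat S')) T', b')))"
    using sigma_C_eq[OF ST] part_YT[OF U]
    unfolding Let_def m_def by blast
qed

section \<open>From pairs to tuples\<close>

lemma braid_at_append:
  assumes "\<sigma> (P, Q) = (A, B)"
  shows "braid_at \<sigma> (Suc (length s)) (s @ P # Q # t) = s @ A # B # t"
  using assms by (simp add: braid_at_def nth_append)

lemma braid_at_raise_tuple:
  assumes \<sigma>: "raising_invariant n \<sigma>" and t: "t \<in> tuples n k" and l: "l \<in> {1..<k}" and i: "i \<in> {1..<n}"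
  shows "braid_at \<sigma> l t \<in> tuples n k"
    and "carry i c (tuple_reading (braid_at \<sigma> l t)) = carry i c (tuple_reading t)"
    and "braid_at \<sigma> l (raise_tuple i c t) = raise_tuple i c (braid_at \<sigma> l t)"
proof -
  have len: "length t = k" using t by (simp add: tuples_def)
  obtain S a where S: "t ! (l - 1) = (S, a)" by fastforce
  obtain T b where T: "t ! l = (T, b)" by fastforce
  let ?s = "take (l - 1) t" and ?u = "drop (Suc l) t"
  have "t = ?s @ t ! (l - 1) # drop (Suc (l - 1)) t"
    using l len by (intro id_take_nth_drop) auto
  also have "drop (Suc (l - 1)) t = t ! l # ?u"
    using l len by (simp add: Cons_nth_drop_Suc)
  finally have split: "t = ?s @ (S, a) # (T, b) # ?u" by (simp only: S T)
  have "set t \<subseteq> YT n \<times> UNIV" using t by (simp add: tuples_def)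
  then have YT: "S \<in> YT n" "T \<in> YT n" "set ?s \<subseteq> YT n \<times> UNIV" "set ?u \<subseteq> YT n \<times> UNIV"
    by (subst (asm) split, simp)+
  obtain S' a' T' b' where *: "\<sigma> ((S, a), (T, b)) = ((S', a'), (T', b'))" "S' \<in> YT n" "T' \<in> YT n"
    and inv: "\<And>c. carry i c (concat S' @ concat T') = carry i c (concat S @ concat T)"
      "\<And>c. \<sigma> ((raise_tableau i c S, a), (raise_tableau i (carry i c (concat S)) T, b)) =
           ((raise_tableau i c S', a'), (raise_tableau i (carry i c (concat S')) T', b'))"
    using \<sigma> YT(1,2) i unfolding raising_invariant_def by metis
  have ls: "l = Suc (length ?s)" using l len by (auto simp: min_def)
  have br: "braid_at \<sigma> l t = ?s @ (S', a') # (T', b') # ?u"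
    by (subst split, subst ls) (rule braid_at_append[of \<sigma>, OF *(1)])
  show "braid_at \<sigma> l t \<in> tuples n k"
    using YT *(2,3) l len unfolding br tuples_def by auto
  show "carry i c (tuple_reading (braid_at \<sigma> l t)) = carry i c (tuple_reading t)"
    unfolding br by (subst (3) split) (use inv(1) in simp)
  \<comment> \<open>This is the counter value at which the pair is read. The braiding preserves the
    value after the pair, so the remaining entries are raised alike on both sides.\<close>
  let ?c = "carry i c (tuple_reading ?s)"
  have "raise_tuple i c t = raise_tuple i c ?s @ (raise_tableau i ?c S, a) #
      (raise_tableau i (carry i ?c (concat S)) T, b) #
      raise_tuple i (carry i ?c (concat S @ concat T)) ?u"
    by (subst split) simp
  moreover have "l = Suc (length (raise_tuple i c ?s))" using ls by simp
  ultimately have "braid_at \<sigma> l (raise_tuple i c t) =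
      raise_tuple i c ?s @ (raise_tableau i ?c S', a') #
      (raise_tableau i (carry i ?c (concat S')) T', b') #
      raise_tuple i (carry i ?c (concat S @ concat T)) ?u"
    using braid_at_append[of \<sigma>, OF inv(2)] by metis
  also have "\<dots> = raise_tuple i c (braid_at \<sigma> l t)"
    unfolding br inv(1)[symmetric] by simp
  finally show "braid_at \<sigma> l (raise_tuple i c t) = raise_tuple i c (braid_at \<sigma> l t)" .
qed

text \<open>On a balanced tuple \<open>s_tuple\<close> raises, and on its raised image it goes back.
  Braiding preserves balance at the same \<open>c\<close>, so \<open>braid_at_raise_tuple\<close>
  settles both directions.\<close>

lemma s_tuple_braid_at:
  assumes "raising_invariant n \<sigma>" "t \<in> tuples n k" "l \<in> {1..<k}" "i \<in> {1..<n}"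
  shows "s_tuple i (braid_at \<sigma> l t) = braid_at \<sigma> l (s_tuple i t)"
proof -
  obtain u c where u: "u \<in> tuples n k" "carry i c (tuple_reading u) = c"
    and t: "t = u \<or> t = raise_tuple i c u"
    using tuple_cases[OF assms(2,4)] by metis
  note br = braid_at_raise_tuple[OF assms(1) u(1) assms(3,4)]
  have fixed: "carry i c (tuple_reading (braid_at \<sigma> l u)) = c" using br(2) u(2) by simp
  show ?thesis
    using t s_tuple_raise_tuple[OF br(1) assms(4) fixed]
      s_tuple_raise_tuple[OF u(1) assms(4) u(2)] br(3) by metis
qed

lemma s_tuple_tuples:
  assumes "t \<in> tuples n k" "i \<in> {1..<n}"
  shows "s_tuple i t \<in> tuples n k"
proof -
  obtain u c where u: "u \<in> tuples n k" "carry i c (tuple_reading u) = c"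
    and t: "t = u \<or> t = raise_tuple i c u"
    using tuple_cases[OF assms] by metis
  then show ?thesis
    using s_tuple_raise_tuple[OF u(1) assms(2) u(2)] raise_tuple_tuples[OF u(1) assms(2)] by metis
qed

section \<open>From generators to the two actions\<close>

lemma permutes_adjacent_induct [consumes 1, case_names id comp adjacent]:
  assumes "p permutes {1..n::nat}"
    and id: "P id"
    and comp: "\<And>p q. p permutes {1..n} \<Longrightarrow> q permutes {1..n} \<Longrightarrow> P p \<Longrightarrow> P q \<Longrightarrow> P (p \<circ> q)"
    and adj: "\<And>i. i \<in> {1..<n} \<Longrightarrow> P (Transposition.transpose i (i + 1))"
  shows "P p"
proof -
  have swap: "P (Transposition.transpose a (a + d))" if "a \<in> {1..n}" "a + d \<in> {1..n}" for a d
    using that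
  proof (induction d)
    case 0
    then show ?case using id by (simp add: id_def)
  next
    case (Suc d)
    let ?x = "Transposition.transpose a (a + d)"
      and ?y = "Transposition.transpose (a + d) (a + d + 1)"
    have x: "P ?x" "?x permutes {1..n}" using Suc by (auto intro!: permutes_swap_id)
    have y: "P ?y" "?y permutes {1..n}" using Suc.prems adj[of "a + d"] by (auto intro!: permutes_swap_id)
    show ?case
    proof (cases "d = 0")
      case True
      then show ?thesis using y(1) by simp
    next
      case False
      \<comment> \<open>Conjugating by the next adjacent transposition moves the far end one step.
        The identity needs three distinct points, hence the separate case
        \<open>d = 0\<close>.\<close>
      have "?y \<circ> ?x \<circ> ?y = Transposition.transpose a (a + Suc d)"
        using False transpose_comp_triple[of "a + d + 1" a "a + d"]
        by (simp add: transpose_commute)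
      moreover have "P (?y \<circ> ?x \<circ> ?y)"
        using x y by (intro comp permutes_compose)
      ultimately show ?thesis by simp
    qed
  qed
  have trans: "P (Transposition.transpose a b)" if "a \<in> {1..n}" "b \<in> {1..n}" for a b
    using swap[of a "b - a"] swap[of b "a - b"] that
    by (cases "a \<le> b") (simp_all add: transpose_commute)
  show ?thesis
    using assms(1) finite_atLeastAtMost
  proof (rule permutes_induct)
    show "P (Transposition.transpose a b \<circ> p)"
      if "a \<in> {1..n}" "b \<in> {1..n}" "P p" "p permutes {1..n}" for a b p
      using that by (intro comp permutes_swap_id trans)
  qed (rule id)
qed

lemma braid_class_Cons:
  "braid_class (l # w) = braid_class [l] \<otimes>\<^bsub>braid_monoid k\<^esub> braid_class w"
  by (simp add: braid_class_mult)

text \<open>For a single \<open>s_tuple i\<close>, induction runs over a word representing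
  \<open>\<beta>\<close>. Adjacent transpositions then generate the whole symmetric group.\<close>

lemma actions_commute:
  assumes \<sigma>: "raising_invariant n \<sigma>"
    and \<rho>: "is_letter_action n k \<rho>" and \<theta>: "is_braid_action \<sigma> n k \<theta>"
    and "\<pi> \<in> carrier (sym_group n)" "\<beta> \<in> carrier (braid_monoid k)" "t \<in> tuples n k"
  shows "\<rho> \<pi> (\<theta> \<beta> t) = \<theta> \<beta> (\<rho> \<pi> t)"
proof -
  interpret group_action "sym_group n" "tuples n k" \<rho>
    using \<rho> by (simp add: is_letter_action_def)
  have act: "monoid_action (braid_monoid k) (tuples n k) \<theta>"
    and gen: "\<And>l t. l \<in> {1..<k} \<Longrightarrow> t \<in> tuples n k \<Longrightarrow> \<theta> (braid_class [l]) t = braid_at \<sigma> l t"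
    using \<theta> by (auto simp: is_braid_action_def)
  have closed: "\<And>\<beta> t. \<beta> \<in> carrier (braid_monoid k) \<Longrightarrow> t \<in> tuples n k \<Longrightarrow> \<theta> \<beta> t \<in> tuples n k"
    and mult: "\<And>\<alpha> \<beta> t. \<alpha> \<in> carrier (braid_monoid k) \<Longrightarrow> \<beta> \<in> carrier (braid_monoid k) \<Longrightarrow>
      t \<in> tuples n k \<Longrightarrow> \<theta> (\<alpha> \<otimes>\<^bsub>braid_monoid k\<^esub> \<beta>) t = \<theta> \<alpha> (\<theta> \<beta> t)"
    using act by (simp_all add: monoid_action_def)
  have one: "\<And>t. t \<in> tuples n k \<Longrightarrow> \<theta> (braid_class []) t = t"
    using act by (simp add: monoid_action_def braid_monoid_def)
  have letter: "\<And>i t. i \<in> {1..<n} \<Longrightarrow> t \<in> tuples n k \<Longrightarrow> \<rho> (Transposition.transpose i (i + 1)) t = s_tuple i t"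
    using \<rho> by (simp add: is_letter_action_def)
  have carr: "braid_class w \<in> carrier (braid_monoid k)" if "w \<in> lists {1..<k}" for w
    using that by (simp add: braid_monoid_def)
  have adj: "s_tuple i (\<theta> (braid_class w) t) = \<theta> (braid_class w) (s_tuple i t)"
    if w: "w \<in> lists {1..<k}" and i: "i \<in> {1..<n}" and t: "t \<in> tuples n k" for w i t
    using w
  proof (induction w)
    case Nil
    show ?case using one[OF t] one[OF s_tuple_tuples[OF t i]] by simp
  next
    case (Cons l w)
    have l: "l \<in> {1..<k}" and w: "w \<in> lists {1..<k}" using Cons by auto
    have step: "\<theta> (braid_class (l # w)) u = braid_at \<sigma> l (\<theta> (braid_class w) u)"
      if "u \<in> tuples n k" for u
      using mult[OF carr[of "[l]"] carr[OF w] that] gen[OF l closed[OF carr[OF w] that]] l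
      by (simp add: braid_class_Cons[of l w k])
    have IH: "s_tuple i (\<theta> (braid_class w) t) = \<theta> (braid_class w) (s_tuple i t)"
      using Cons.IH .
    show ?case
      unfolding step[OF t] step[OF s_tuple_tuples[OF t i]] IH[symmetric]
      using s_tuple_braid_at[OF \<sigma> closed[OF carr[OF w] t] l i] .
  qed
  obtain w where w: "w \<in> lists {1..<k}" "\<beta> = braid_class w"
    using assms(5) by (auto simp: braid_monoid_def)
  have "\<pi> permutes {1..n}" using assms(4) by (simp add: sym_group_def)
  then have "\<forall>t\<in>tuples n k. \<rho> \<pi> (\<theta> \<beta> t) = \<theta> \<beta> (\<rho> \<pi> t)"
  proof (induction rule: permutes_adjacent_induct)
    case id
    have "\<rho> id t = t" if "t \<in> tuples n k" for t
      using id_eq_one that by (metis restrict_apply' sym_group_one)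
    then show ?case using closed[OF assms(5)] by metis
  next
    case (comp p q)
    have pq: "p \<in> carrier (sym_group n)" "q \<in> carrier (sym_group n)"
      using comp(1,2) by (simp_all add: sym_group_def)
    have c: "\<rho> (p \<circ> q) t = \<rho> p (\<rho> q t)" if "t \<in> tuples n k" for t
      using composition_rule[OF that pq] by (simp add: sym_group_mult)
    show ?case
    proof
      fix t assume t: "t \<in> tuples n k"
      have q: "\<rho> q t \<in> tuples n k" using element_image[OF pq(2) t] by blast
      show "\<rho> (p \<circ> q) (\<theta> \<beta> t) = \<theta> \<beta> (\<rho> (p \<circ> q) t)"
        using comp(3,4) t q by (simp add: c closed[OF assms(5)])
    qed
  next
    case (adjacent i)
    then show ?case
      using adj[OF w(1) adjacent] letter[OF adjacent] closed[OF assms(5)] w(2) by simp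
  qed
  then show ?thesis using assms(6) by blast
qed

theorem theorem5p8:
  fixes n k :: nat
  assumes "n > 0" and "k > 0"
  shows
    "((\<forall>i\<in>{1..<n}. \<forall>l\<in>{1..<k}. \<forall>t\<in>tuples n k.
         s_tuple i (braid_at (sigma_R n) l t) = braid_at (sigma_R n) l (s_tuple i t)) \<and>
      (\<forall>\<rho> \<theta>. is_letter_action n k \<rho> \<longrightarrow> is_braid_action (sigma_R n) n k \<theta> \<longrightarrow>
         (\<forall>\<pi>\<in>carrier (sym_group n). \<forall>\<beta>\<in>carrier (braid_monoid k). \<forall>t\<in>tuples n k.
            \<rho> \<pi> (\<theta> \<beta> t) = \<theta> \<beta> (\<rho> \<pi> t)))) \<and>
     ((\<forall>i\<in>{1..<n}. \<forall>l\<in>{1..<k}. \<forall>t\<in>tuples n k.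
         s_tuple i (braid_at (sigma_C n) l t) = braid_at (sigma_C n) l (s_tuple i t)) \<and>
      (\<forall>\<rho> \<theta>. is_letter_action n k \<rho> \<longrightarrow> is_braid_action (sigma_C n) n k \<theta> \<longrightarrow>
         (\<forall>\<pi>\<in>carrier (sym_group n). \<forall>\<beta>\<in>carrier (braid_monoid k). \<forall>t\<in>tuples n k.
            \<rho> \<pi> (\<theta> \<beta> t) = \<theta> \<beta> (\<rho> \<pi> t))))"
  using s_tuple_braid_at raising_invariant_sigma_R raising_invariant_sigma_C actions_commute by blast

end
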